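(* Let $k$ be a field of characteristic zero and $k_0 \subset k$ a computable subfield, and let $M_2$ be a free monoid with two generators. Then the following problem is undecidable: given a finite set $F$ of $M_2$-polynomials over $k_0$ (in finitely many variables), decide whether $F = 0$ has a solution in $k^{M_2}$.
   Context: For a monoid $M$ (written multiplicatively), the ring $k^M$ of $M$-sequences is the ring of all maps $M\to k$ with componentwise operations and $M$-action $\sigma^m((x_\ell)_{\ell\in M})=(x_{\ell m})_{\ell\in M}$; $k$ embeds as the constant sequences. The ring of $M$-polynomials over $k_0$ in $\mathbf{X}=(X_1,\ldots,X_n)$ is the polynomial ring $k_0[\sigma^m(\mathbf{X})\mid m\in M]$ in the indeterminates $\sigma^m(X_i)$, with $M$ acting trivially on $k_0$ and by $\sigma^{m_1}(\sigma^{m_2}(X_i))=\sigma^{m_1m_2}(X_i)$. A solution of $F=0$ in $k^M$ is a tuple $\mathbf{x}\in(k^M)^n$ such that every $f\in F$ is sent to $0$ by the unique $k_0$-algebra morphism $k_0[\sigma^m(\mathbf{X})\mid m\in M]\to k^M$ commuting with the $M$-action and sending $X_i\mapsto x_i$. "Undecidable" means that no algorithm solves the problem. *)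

theory Defs
  imports
    "HOL-Library.Poly_Mapping"
    "HOL-Library.Function_Algebras"
    "HOL-Library.Nat_Bijection"
begin

section \<open>Computability\<close>

datatype recf =
    Zero
  | Succ
  | Proj nat
  | Comp recf "recf list"
  | PrimRec recf recf
  | Mu recf

text \<open>
  Big-step semantics of the partial recursive functions: \<open>computes f xs y\<close> means that \<open>f\<close>
  halts on the argument list \<open>xs\<close> with value \<open>y\<close>. As usual, composition is strict, and
  unbounded search requires that the function searched through is defined at all smaller arguments.
\<close>

inductive computes :: "recf \<Rightarrow> nat list \<Rightarrow> nat \<Rightarrow> bool" where
  Zero: "computes Zero xs 0"
| Succ: "computes Succ [x] (Suc x)"
| Proj: "i < length xs \<Longrightarrow> computes (Proj i) xs (xs ! i)"
| Comp: "list_all2 (\<lambda>g y. computes g xs y) gs ys \<Longrightarrow> computes f ys z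
    \<Longrightarrow> computes (Comp f gs) xs z"
| PrimRec_0: "computes f xs y \<Longrightarrow> computes (PrimRec f g) (0 # xs) y"
| PrimRec_Suc: "computes (PrimRec f g) (n # xs) y \<Longrightarrow> computes g (n # y # xs) z
    \<Longrightarrow> computes (PrimRec f g) (Suc n # xs) z"
| Mu: "computes f (n # xs) 0 \<Longrightarrow> (\<And>m. m < n \<Longrightarrow> \<exists>y. computes f (m # xs) (Suc y))
    \<Longrightarrow> computes (Mu f) xs n"

inductive_cases computes_cases:
  "computes Zero xs y" "computes Succ xs y" "computes (Proj i) xs y" "computes (Comp f gs) xs y"
  "computes (PrimRec f g) (0 # xs) y" "computes (PrimRec f g) (Suc n # xs) y" "computes (Mu f) xs y"

lemma computes_deterministic: "computes f xs y \<Longrightarrow> computes f xs z \<Longrightarrow> y = z"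
proof (induction arbitrary: z rule: computes.induct)
  case (Zero xs)
  then show ?case by (blast elim: computes_cases(1))
next
  case (Succ x)
  then show ?case by (blast elim: computes_cases(2))
next
  case (Proj i xs)
  from Proj.prems show ?case by (blast elim: computes_cases(3))
next
  case (Comp xs gs ys f y)
  show ?case
  proof (rule computes_cases(4)[OF Comp.prems])
    fix ys' assume ys': "list_all2 (\<lambda>g y. computes g xs y) gs ys'" "computes f ys' z"
    have "ys = ys'"
    proof (rule nth_equalityI)
      show "length ys = length ys'"
        using list_all2_lengthD[OF Comp.IH(1)] list_all2_lengthD[OF ys'(1)] by simp
    next
      fix i assume "i < length ys"
      then show "ys ! i = ys' ! i"
        using Comp.IH(1) ys'(1) unfolding list_all2_conv_all_nth by metis
    qed
    with ys'(2) Comp.IH(2) show ?case by blast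
  qed
next
  case (PrimRec_0 f xs y g)
  show ?case by (rule computes_cases(5)[OF PrimRec_0.prems]) (rule PrimRec_0.IH)
next
  case (PrimRec_Suc f g n xs y w)
  show ?case
  proof (rule computes_cases(6)[OF PrimRec_Suc.prems])
    fix y' assume "computes (PrimRec f g) (n # xs) y'" "computes g (n # y' # xs) z"
    with PrimRec_Suc.IH show ?case by blast
  qed
next
  case (Mu f n xs)
  show ?case
  proof (rule computes_cases(7)[OF Mu.prems])
    assume z: "computes f (z # xs) 0" "\<And>m. m < z \<Longrightarrow> \<exists>y. computes f (m # xs) (Suc y)"
    show ?case
    proof (rule linorder_cases[of n z])
      assume "n < z"
      from z(2)[OF this] Mu.IH(1) show ?thesis by blast
    next
      assume "z < n"
      from Mu.IH(2)[OF this] z(1) show ?thesis by blast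
    qed
  qed
qed

text \<open>
  A decision problem consists of a set \<open>I\<close> of instances, a relation \<open>codes c i\<close> (the number
  \<open>c\<close> is an encoding of the instance \<open>i\<close>; an instance may have several encodings), and a
  property \<open>P\<close> of instances. No requirement is put on the behaviour of the algorithm on
  numbers that do not encode an instance.
\<close>

definition decidable_problem :: "(nat \<Rightarrow> 'i \<Rightarrow> bool) \<Rightarrow> 'i set \<Rightarrow> ('i \<Rightarrow> bool) \<Rightarrow> bool" where
  "decidable_problem codes I P \<longleftrightarrow>
     (\<exists>f. \<forall>i\<in>I. \<forall>c. codes c i \<longrightarrow> computes f [c] (if P i then 1 else 0))"

abbreviation undecidable_problem :: "(nat \<Rightarrow> 'i \<Rightarrow> bool) \<Rightarrow> 'i set \<Rightarrow> ('i \<Rightarrow> bool) \<Rightarrow> bool" where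
  "undecidable_problem codes I P \<equiv> \<not> decidable_problem codes I P"


section \<open>Computable subfields\<close>

definition is_subfield :: "'k::field set \<Rightarrow> bool" where
  "is_subfield K \<longleftrightarrow> 0 \<in> K \<and> 1 \<in> K \<and>
     (\<forall>x\<in>K. \<forall>y\<in>K. x + y \<in> K \<and> x * y \<in> K) \<and> (\<forall>x\<in>K. - x \<in> K \<and> inverse x \<in> K)"

text \<open>
  Computable fields in the sense of Rabin: the elements are coded injectively by the members of a
  recursive set of natural numbers, such that addition and multiplication become recursive.
  Negation and inversion are then recursive as well, by unbounded search.
\<close>

definition computable_coding :: "'k::field set \<Rightarrow> ('k \<Rightarrow> nat) \<Rightarrow> bool" where
  "computable_coding K enc \<longleftrightarrow> inj_on enc K \<and>
     (\<exists>f. \<forall>c. computes f [c] (if c \<in> enc ` K then 1 else 0)) \<and>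
     (\<exists>f. \<forall>x\<in>K. \<forall>y\<in>K. computes f [enc x, enc y] (enc (x + y))) \<and>
     (\<exists>f. \<forall>x\<in>K. \<forall>y\<in>K. computes f [enc x, enc y] (enc (x * y)))"


section \<open>The free monoid\<close>

datatype 'a free_monoid = Word (letters: "'a list")

instantiation free_monoid :: (type) monoid_mult
begin

definition one_free_monoid :: "'a free_monoid" where
  "1 = Word []"

definition times_free_monoid :: "'a free_monoid \<Rightarrow> 'a free_monoid \<Rightarrow> 'a free_monoid" where
  "u * v = Word (letters u @ letters v)"

instance
  by standard (simp_all add: one_free_monoid_def times_free_monoid_def)

end

type_synonym M2 = "bool free_monoid"


section \<open>Sequences and polynomials over a monoid\<close>

text \<open>
  The ring of \<open>M\<close>-sequences is the function type \<open>'m \<Rightarrow> 'k\<close> with its pointwise operations.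
\<close>

definition seq_shift :: "'m::monoid_mult \<Rightarrow> ('m \<Rightarrow> 'k) \<Rightarrow> 'm \<Rightarrow> 'k" where
  "seq_shift m x = (\<lambda>l. x (l * m))"

definition const_seq :: "'k \<Rightarrow> 'm \<Rightarrow> 'k" where
  "const_seq a = (\<lambda>_. a)"

text \<open>
  Polynomials in the indeterminates \<open>\<sigma>\<^sup>m(X\<^sub>i)\<close>, which are represented by the pairs \<open>(i, m)\<close>; the
  variables \<open>X\<^sub>i\<close> are numbered from \<open>0\<close>.
\<close>

type_synonym ('m, 'k) mpoly = "(nat \<times> 'm \<Rightarrow>\<^sub>0 nat) \<Rightarrow>\<^sub>0 'k"

definition Const :: "'k \<Rightarrow> ('m, 'k::zero) mpoly" where
  "Const a = Poly_Mapping.single 0 a"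

definition Indet :: "nat \<times> 'm \<Rightarrow> ('m, 'k::zero_neq_one) mpoly" where
  "Indet v = Poly_Mapping.single (Poly_Mapping.single v 1) 1"

definition mpolys :: "nat \<Rightarrow> 'k set \<Rightarrow> ('m, 'k::zero) mpoly set" where
  "mpolys n K = {p. \<forall>t\<in>Poly_Mapping.keys p. Poly_Mapping.lookup p t \<in> K \<and>
     (\<forall>(i, m)\<in>Poly_Mapping.keys t. i < n)}"

text \<open>Substitution of ring elements for the indeterminates, via \<open>h\<close> on the coefficients.\<close>

definition mpoly_subst ::
  "('k \<Rightarrow> 'r) \<Rightarrow> (nat \<times> 'm \<Rightarrow> 'r) \<Rightarrow> ('m, 'k::zero) mpoly \<Rightarrow> 'r::comm_ring_1" where
  "mpoly_subst h g p = (\<Sum>t\<in>Poly_Mapping.keys p. h (Poly_Mapping.lookup p t) *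
     (\<Prod>v\<in>Poly_Mapping.keys t. g v ^ Poly_Mapping.lookup t v))"

definition mpoly_act :: "'m::monoid_mult \<Rightarrow> ('m, 'k::comm_ring_1) mpoly \<Rightarrow> ('m, 'k) mpoly" where
  "mpoly_act m = mpoly_subst Const (\<lambda>(i, l). Indet (i, m * l))"

text \<open>
  The algebra morphism commuting with the \<open>M\<close>-action and sending \<open>X\<^sub>i\<close> to \<open>xs ! i\<close>. That this is
  such a morphism, and the only one, is proved below.
\<close>

definition mpoly_eval ::
  "('m \<Rightarrow> 'k) list \<Rightarrow> ('m::monoid_mult, 'k::comm_ring_1) mpoly \<Rightarrow> 'm \<Rightarrow> 'k" where
  "mpoly_eval xs = mpoly_subst const_seq (\<lambda>(i, m). seq_shift m (xs ! i))"

definition is_solution ::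
  "nat \<Rightarrow> ('m::monoid_mult, 'k::comm_ring_1) mpoly set \<Rightarrow> ('m \<Rightarrow> 'k) list \<Rightarrow> bool" where
  "is_solution n F xs \<longleftrightarrow> length xs = n \<and> (\<forall>f\<in>F. mpoly_eval xs f = 0)"


subsection \<open>Characterization of the evaluation morphism\<close>

locale coeff_hom =
  fixes h :: "'k::comm_ring_1 \<Rightarrow> 'r::comm_ring_1"
  assumes h_0: "h 0 = 0" and h_1: "h 1 = 1"
    and h_add: "h (a + b) = h a + h b" and h_mult: "h (a * b) = h a * h b"
begin

definition mon :: "(nat \<times> 'm \<Rightarrow> 'r) \<Rightarrow> (nat \<times> 'm \<Rightarrow>\<^sub>0 nat) \<Rightarrow> 'r" where
  "mon g t = (\<Prod>v\<in>Poly_Mapping.keys t. g v ^ Poly_Mapping.lookup t v)"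

lemma mon_superset:
  "finite A \<Longrightarrow> Poly_Mapping.keys t \<subseteq> A \<Longrightarrow> mon g t = (\<Prod>v\<in>A. g v ^ Poly_Mapping.lookup t v)"
  unfolding mon_def by (intro prod.mono_neutral_left) (auto simp: in_keys_iff)

lemma mon_add: "mon g (s + t) = mon g s * mon g t"
proof -
  let ?A = "Poly_Mapping.keys s \<union> Poly_Mapping.keys t"
  have "mon g (s + t) = (\<Prod>v\<in>?A. g v ^ Poly_Mapping.lookup (s + t) v)"
    using keys_add[of s t] by (intro mon_superset) auto
  also have "\<dots> = mon g s * mon g t"
    by (simp add: mon_superset[of ?A s] mon_superset[of ?A t] lookup_add power_add prod.distrib)
  finally show ?thesis .
qed

lemma subst_superset:
  "finite A \<Longrightarrow> Poly_Mapping.keys p \<subseteq> A \<Longrightarrow>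
     mpoly_subst h g p = (\<Sum>t\<in>A. h (Poly_Mapping.lookup p t) * mon g t)"
  unfolding mpoly_subst_def mon_def
  by (intro sum.mono_neutral_left) (auto simp: in_keys_iff h_0)

lemma subst_0: "mpoly_subst h g 0 = 0"
  by (simp add: mpoly_subst_def)

lemma subst_add: "mpoly_subst h g (p + q) = mpoly_subst h g p + mpoly_subst h g q"
proof -
  let ?A = "Poly_Mapping.keys p \<union> Poly_Mapping.keys q"
  have "mpoly_subst h g (p + q) = (\<Sum>t\<in>?A. h (Poly_Mapping.lookup (p + q) t) * mon g t)"
    using keys_add[of p q] by (intro subst_superset) auto
  also have "\<dots> = mpoly_subst h g p + mpoly_subst h g q"
    by (simp add: subst_superset[of ?A p] subst_superset[of ?A q] lookup_add h_add
        distrib_right sum.distrib)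
  finally show ?thesis .
qed

lemma subst_single: "mpoly_subst h g (Poly_Mapping.single t a) = h a * mon g t"
  using subst_superset[of "{t}" "Poly_Mapping.single t a" g] by simp

lemma subst_sum: "mpoly_subst h g (sum f A) = (\<Sum>a\<in>A. mpoly_subst h g (f a))"
  by (induction A rule: infinite_finite_induct) (simp_all add: subst_0 subst_add)

lemma sum_single: "(\<Sum>t\<in>Poly_Mapping.keys p. Poly_Mapping.single t (Poly_Mapping.lookup p t)) = p"
  by (rule poly_mapping_eqI) (auto simp: lookup_sum lookup_single when_def in_keys_iff)

lemma subst_mult: "mpoly_subst h g (p * q) = mpoly_subst h g p * mpoly_subst h g q"
proof -
  let ?P = "\<lambda>t. Poly_Mapping.single t (Poly_Mapping.lookup p t)"
  let ?Q = "\<lambda>t. Poly_Mapping.single t (Poly_Mapping.lookup q t)"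
  have "p * q = (\<Sum>s\<in>Poly_Mapping.keys p. ?P s) * (\<Sum>t\<in>Poly_Mapping.keys q. ?Q t)"
    using arg_cong2[OF sum_single[of p, symmetric] sum_single[of q, symmetric], of "(*)"] .
  also have "\<dots> = (\<Sum>s\<in>Poly_Mapping.keys p. \<Sum>t\<in>Poly_Mapping.keys q. ?P s * ?Q t)"
    by (simp only: sum_product)
  finally have "mpoly_subst h g (p * q) = (\<Sum>s\<in>Poly_Mapping.keys p. \<Sum>t\<in>Poly_Mapping.keys q.
      (h (Poly_Mapping.lookup p s) * mon g s) * (h (Poly_Mapping.lookup q t) * mon g t))"
    by (simp add: subst_sum mult_single subst_single h_mult mon_add mult_ac)
  also have "\<dots> = mpoly_subst h g p * mpoly_subst h g q"
    by (simp only: sum_product[symmetric] mpoly_subst_def mon_def)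
  finally show ?thesis .
qed

lemma subst_Const: "mpoly_subst h g (Const a) = h a"
  by (simp add: Const_def subst_single mon_def)

lemma subst_Indet: "mpoly_subst h g (Indet v) = g v"
  by (simp add: Indet_def subst_single mon_def h_1)

lemma subst_1: "mpoly_subst h g 1 = 1"
  using subst_Const[of g 1] by (simp add: Const_def h_1)

lemma subst_power: "mpoly_subst h g (p ^ e) = mpoly_subst h g p ^ e"
  by (induction e) (simp_all add: subst_1 subst_mult)

lemma subst_prod: "mpoly_subst h g (prod f A) = (\<Prod>a\<in>A. mpoly_subst h g (f a))"
  by (induction A rule: infinite_finite_induct) (simp_all add: subst_1 subst_mult)

end

interpretation const_seq: coeff_hom const_seq
  by standard (simp_all add: const_seq_def fun_eq_iff)

interpretation Const: coeff_hom Const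
  by standard (simp_all add: Const_def single_add mult_single)

lemma mpoly_eval_Const: "mpoly_eval xs (Const a) = const_seq a"
  by (simp add: mpoly_eval_def const_seq.subst_Const)

lemma mpoly_eval_add: "mpoly_eval xs (p + q) = mpoly_eval xs p + mpoly_eval xs q"
  by (simp add: mpoly_eval_def const_seq.subst_add)

lemma mpoly_eval_mult: "mpoly_eval xs (p * q) = mpoly_eval xs p * mpoly_eval xs q"
  by (simp add: mpoly_eval_def const_seq.subst_mult)

lemma mpoly_eval_Indet: "mpoly_eval xs (Indet (i, m)) = seq_shift m (xs ! i)"
  by (simp add: mpoly_eval_def const_seq.subst_Indet)

lemma mpoly_eval_X: "mpoly_eval xs (Indet (i, 1)) = xs ! i"
  by (simp add: mpoly_eval_Indet seq_shift_def)

lemma mpoly_act_Const: "mpoly_act m (Const a) = Const a"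
  by (simp add: mpoly_act_def Const.subst_Const)

lemma mpoly_act_Indet: "mpoly_act m (Indet (i, l)) = Indet (i, m * l)"
  by (simp add: mpoly_act_def Const.subst_Indet)

lemma seq_shift_sum: "seq_shift m (sum f A) = (\<Sum>a\<in>A. seq_shift m (f a))"
  by (induction A rule: infinite_finite_induct) (simp_all add: seq_shift_def fun_eq_iff)

lemma seq_shift_prod: "seq_shift m (prod f A) = (\<Prod>a\<in>A. seq_shift m (f a))"
  by (induction A rule: infinite_finite_induct) (simp_all add: seq_shift_def fun_eq_iff)

lemma seq_shift_mult: "seq_shift m (x * y) = seq_shift m x * seq_shift m y"
  by (simp add: seq_shift_def fun_eq_iff)

lemma seq_shift_power: "seq_shift m (x ^ e) = seq_shift m x ^ e"
  by (induction e) (auto simp: seq_shift_def fun_eq_iff)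

lemma mpoly_eval_act:
  fixes xs :: "('m::monoid_mult \<Rightarrow> 'k::comm_ring_1) list"
  shows "mpoly_eval xs (mpoly_act m p) = seq_shift m (mpoly_eval xs p)"
proof -
  have 1: "seq_shift m (const_seq a) = const_seq a" for m :: 'm and a :: 'k
    by (simp add: seq_shift_def const_seq_def)
  have 2: "seq_shift (m * l) x = seq_shift m (seq_shift l x)" for m l and x :: "'m \<Rightarrow> 'k"
    by (simp add: seq_shift_def mult.assoc)
  show ?thesis
    unfolding mpoly_eval_def mpoly_act_def
    by (subst (2 3) mpoly_subst_def)
      (simp add: const_seq.subst_sum const_seq.subst_mult const_seq.subst_prod
        const_seq.subst_power const_seq.subst_Const const_seq.subst_Indet case_prod_beta
        seq_shift_sum seq_shift_prod seq_shift_mult seq_shift_power 1 2)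
qed

lemma Const_0: "Const 0 = 0" and Const_1: "Const 1 = 1"
  by (simp_all add: Const_def)

lemma subst_Const_Indet:
  fixes p :: "('m, 'k::comm_ring_1) mpoly"
  shows "mpoly_subst Const Indet p = p"
proof -
  have power: "Indet v ^ e = Poly_Mapping.single (Poly_Mapping.single v e) (1 :: 'k)"
    for v :: "nat \<times> 'm" and e
    by (induction e) (simp_all add: Indet_def mult_single single_add[symmetric])
  have prod: "(\<Prod>v\<in>A. Poly_Mapping.single (f v) 1) = Poly_Mapping.single (sum f A) (1 :: 'k)"
    for f :: "nat \<times> 'm \<Rightarrow> (nat \<times> 'm \<Rightarrow>\<^sub>0 nat)" and A
    by (induction A rule: infinite_finite_induct) (simp_all add: mult_single)
  have exps: "(\<Sum>v\<in>Poly_Mapping.keys t. Poly_Mapping.single v (Poly_Mapping.lookup t v)) = t"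
    for t :: "nat \<times> 'm \<Rightarrow>\<^sub>0 nat"
    by (rule poly_mapping_eqI) (auto simp: lookup_sum lookup_single when_def in_keys_iff)
  show ?thesis
    unfolding mpoly_subst_def power prod exps
    by (simp add: Const_def mult_single Const.sum_single)
qed

context
  fixes K :: "'k::field set" and n :: nat
  assumes K: "is_subfield K"
begin

lemma mpolys_0: "0 \<in> mpolys n K"
  by (simp add: mpolys_def)

lemma mpolys_add:
  fixes p q :: "('m, 'k) mpoly"
  shows "p \<in> mpolys n K \<Longrightarrow> q \<in> mpolys n K \<Longrightarrow> p + q \<in> mpolys n K"
proof -
  assume pq: "p \<in> mpolys n K" "q \<in> mpolys n K"
  have "Poly_Mapping.lookup r t \<in> K" if "r \<in> mpolys n K" for r :: "('m, 'k) mpoly" and t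
    using that K by (cases "t \<in> Poly_Mapping.keys r") (auto simp: mpolys_def is_subfield_def in_keys_iff)
  with pq have "Poly_Mapping.lookup (p + q) t \<in> K" for t
    using K by (simp add: lookup_add is_subfield_def)
  with pq show ?thesis
    using keys_add[of p q] unfolding mpolys_def by blast
qed

lemma mpolys_sum: "(\<And>a. a \<in> A \<Longrightarrow> f a \<in> mpolys n K) \<Longrightarrow> sum f A \<in> mpolys n K"
  by (induction A rule: infinite_finite_induct) (simp_all add: mpolys_0 mpolys_add)

lemma mpolys_Const: "a \<in> K \<Longrightarrow> Const a \<in> mpolys n K"
  by (simp add: mpolys_def Const_def)

lemma mpolys_Indet: "i < n \<Longrightarrow> Indet (i, m) \<in> mpolys n K"
  using K by (simp add: mpolys_def Indet_def is_subfield_def)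

lemma mpolys_mult: "p \<in> mpolys n K \<Longrightarrow> q \<in> mpolys n K \<Longrightarrow> p * q \<in> mpolys n K"
proof -
  assume pq: "p \<in> mpolys n K" "q \<in> mpolys n K"
  let ?P = "\<lambda>t. Poly_Mapping.single t (Poly_Mapping.lookup p t)"
  let ?Q = "\<lambda>t. Poly_Mapping.single t (Poly_Mapping.lookup q t)"
  have "p * q = (\<Sum>s\<in>Poly_Mapping.keys p. ?P s) * (\<Sum>t\<in>Poly_Mapping.keys q. ?Q t)"
    using arg_cong2[OF Const.sum_single[of p, symmetric] Const.sum_single[of q, symmetric], of "(*)"] .
  also have "\<dots> = (\<Sum>s\<in>Poly_Mapping.keys p. \<Sum>t\<in>Poly_Mapping.keys q. ?P s * ?Q t)"
    by (simp only: sum_product)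
  also have "\<dots> \<in> mpolys n K"
  proof (intro mpolys_sum)
    fix s t assume st: "s \<in> Poly_Mapping.keys p" "t \<in> Poly_Mapping.keys q"
    have "\<forall>(i, m)\<in>Poly_Mapping.keys (s + t). i < n"
      using st pq keys_add[of s t] unfolding mpolys_def by blast
    moreover have "Poly_Mapping.lookup p s * Poly_Mapping.lookup q t \<in> K"
      using st pq K unfolding mpolys_def is_subfield_def by blast
    ultimately show "?P s * ?Q t \<in> mpolys n K"
      by (simp add: mult_single mpolys_def)
  qed
  finally show ?thesis .
qed

lemma mpolys_1: "1 \<in> mpolys n K"
  using mpolys_Const[of 1] K by (simp add: Const_1 is_subfield_def)

lemma mpolys_power: "p \<in> mpolys n K \<Longrightarrow> p ^ e \<in> mpolys n K"
  by (induction e) (simp_all add: mpolys_1 mpolys_mult)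

lemma mpolys_prod: "(\<And>a. a \<in> A \<Longrightarrow> f a \<in> mpolys n K) \<Longrightarrow> prod f A \<in> mpolys n K"
  by (induction A rule: infinite_finite_induct) (simp_all add: mpolys_1 mpolys_mult)

end

theorem mpoly_eval_unique:
  fixes \<phi> :: "('m::monoid_mult, 'k::field) mpoly \<Rightarrow> 'm \<Rightarrow> 'k"
  assumes K: "is_subfield K"
    and add: "\<And>p q. p \<in> mpolys n K \<Longrightarrow> q \<in> mpolys n K \<Longrightarrow> \<phi> (p + q) = \<phi> p + \<phi> q"
    and mult: "\<And>p q. p \<in> mpolys n K \<Longrightarrow> q \<in> mpolys n K \<Longrightarrow> \<phi> (p * q) = \<phi> p * \<phi> q"
    and const: "\<And>a. a \<in> K \<Longrightarrow> \<phi> (Const a) = const_seq a"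
    and act: "\<And>p m. p \<in> mpolys n K \<Longrightarrow> \<phi> (mpoly_act m p) = seq_shift m (\<phi> p)"
    and X: "\<And>i. i < n \<Longrightarrow> \<phi> (Indet (i, 1)) = xs ! i"
    and p: "p \<in> mpolys n K"
  shows "\<phi> p = mpoly_eval xs p"
proof -
  note clos = mpolys_0[OF K] mpolys_add[OF K] mpolys_mult[OF K] mpolys_1[OF K]
  have K01: "0 \<in> K" "1 \<in> K"
    using K by (simp_all add: is_subfield_def)
  have \<phi>_0: "\<phi> 0 = 0"
    using const[OF K01(1)] by (simp add: Const_0 const_seq_def zero_fun_def)
  have \<phi>_1: "\<phi> 1 = 1"
    using const[OF K01(2)] by (simp add: Const_1 const_seq_def one_fun_def)
  have \<phi>_sum: "\<phi> (sum f A) = (\<Sum>a\<in>A. \<phi> (f a))" if "\<And>a. a \<in> A \<Longrightarrow> f a \<in> mpolys n K"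
    for f :: "(nat \<times> 'm \<Rightarrow>\<^sub>0 nat) \<Rightarrow> ('m, 'k) mpoly" and A
    using that
    by (induction A rule: infinite_finite_induct) (simp_all add: \<phi>_0 add mpolys_sum[OF K])
  have \<phi>_prod: "\<phi> (prod f A) = (\<Prod>a\<in>A. \<phi> (f a))" if "\<And>a. a \<in> A \<Longrightarrow> f a \<in> mpolys n K"
    for f :: "nat \<times> 'm \<Rightarrow> ('m, 'k) mpoly" and A
    using that
    by (induction A rule: infinite_finite_induct) (simp_all add: \<phi>_1 mult mpolys_prod[OF K])
  have \<phi>_power: "\<phi> (q ^ e) = \<phi> q ^ e" if "q \<in> mpolys n K" for q e
    using that by (induction e) (simp_all add: \<phi>_1 mult mpolys_power[OF K])
  have \<phi>_Indet: "\<phi> (Indet (i, m)) = seq_shift m (xs ! i)" if "i < n" for i m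
    using act[OF mpolys_Indet[OF K that], of m 1] X[OF that] by (simp add: mpoly_act_Indet)
  have keys: "Poly_Mapping.lookup p t \<in> K" "\<And>i m. (i, m) \<in> Poly_Mapping.keys t \<Longrightarrow> i < n"
    if "t \<in> Poly_Mapping.keys p" for t
    using that p unfolding mpolys_def by blast+
  let ?M = "\<lambda>t. \<Prod>v\<in>Poly_Mapping.keys t. Indet v ^ Poly_Mapping.lookup t v :: ('m, 'k) mpoly"
  have fac: "Indet v ^ e \<in> mpolys n K" "\<phi> (Indet v ^ e) = (case v of (i, m) \<Rightarrow> seq_shift m (xs ! i)) ^ e"
    if "t \<in> Poly_Mapping.keys p" "v \<in> Poly_Mapping.keys t" for t v e
    using keys(2)[OF that(1), of "fst v" "snd v"] that(2)
    by (cases v; simp add: mpolys_power[OF K] mpolys_Indet[OF K] \<phi>_power \<phi>_Indet)+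
  have mon: "?M t \<in> mpolys n K" if "t \<in> Poly_Mapping.keys p" for t
    using that by (intro mpolys_prod[OF K] fac(1))
  have "\<phi> p = \<phi> (\<Sum>t\<in>Poly_Mapping.keys p. Const (Poly_Mapping.lookup p t) * ?M t)"
    using arg_cong[OF subst_Const_Indet[of p], of \<phi>] by (simp add: mpoly_subst_def)
  also have "\<dots> = (\<Sum>t\<in>Poly_Mapping.keys p. \<phi> (Const (Poly_Mapping.lookup p t) * ?M t))"
    by (intro \<phi>_sum mpolys_mult[OF K] mpolys_Const[OF K] mon keys)
  also have "\<dots> = (\<Sum>t\<in>Poly_Mapping.keys p. const_seq (Poly_Mapping.lookup p t) *
      (\<Prod>v\<in>Poly_Mapping.keys t. (case v of (i, m) \<Rightarrow> seq_shift m (xs ! i)) ^ Poly_Mapping.lookup t v))"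
  proof (rule sum.cong[OF refl])
    fix t assume t: "t \<in> Poly_Mapping.keys p"
    have "\<phi> (?M t) = (\<Prod>v\<in>Poly_Mapping.keys t. \<phi> (Indet v ^ Poly_Mapping.lookup t v))"
      using t by (intro \<phi>_prod fac(1))
    also have "\<dots> = (\<Prod>v\<in>Poly_Mapping.keys t. (case v of (i, m) \<Rightarrow> seq_shift m (xs ! i)) ^ Poly_Mapping.lookup t v)"
      using t by (intro prod.cong refl fac(2))
    finally show "\<phi> (Const (Poly_Mapping.lookup p t) * ?M t) = const_seq (Poly_Mapping.lookup p t) *
      (\<Prod>v\<in>Poly_Mapping.keys t. (case v of (i, m) \<Rightarrow> seq_shift m (xs ! i)) ^ Poly_Mapping.lookup t v)"
      using mult[OF mpolys_Const[OF K keys(1)[OF t]] mon[OF t]] const[OF keys(1)[OF t]] by simp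
  qed
  also have "\<dots> = mpoly_eval xs p"
    by (simp add: mpoly_eval_def mpoly_subst_def)
  finally show ?thesis .
qed


section \<open>Coding of finite systems over the free monoid\<close>

text \<open>
  A polynomial is written as a list of terms, each consisting of a coefficient and a list of
  indeterminates; repetitions are allowed, so that a polynomial has many such expressions.
\<close>

type_synonym 'k mexpr = "('k \<times> (nat \<times> M2) list) list"

definition mexpr_poly :: "'k::comm_ring_1 mexpr \<Rightarrow> (M2, 'k) mpoly" where
  "mexpr_poly e = (\<Sum>(a, vs)\<leftarrow>e. Const a * (\<Prod>v\<leftarrow>vs. Indet v))"

definition mexprs :: "nat \<Rightarrow> 'k set \<Rightarrow> 'k mexpr set" where
  "mexprs n K = {e. \<forall>(a, vs)\<in>set e. a \<in> K \<and> (\<forall>(i, m)\<in>set vs. i < n)}"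

definition word_code :: "M2 \<Rightarrow> nat" where
  "word_code w = list_encode (map of_bool (letters w))"

definition indet_code :: "nat \<times> M2 \<Rightarrow> nat" where
  "indet_code = (\<lambda>(i, m). prod_encode (i, word_code m))"

definition term_code :: "('k \<Rightarrow> nat) \<Rightarrow> 'k \<times> (nat \<times> M2) list \<Rightarrow> nat" where
  "term_code enc = (\<lambda>(a, vs). prod_encode (enc a, list_encode (map indet_code vs)))"

definition mexpr_code :: "('k \<Rightarrow> nat) \<Rightarrow> 'k mexpr \<Rightarrow> nat" where
  "mexpr_code enc e = list_encode (map (term_code enc) e)"

definition system_code ::
  "'k set \<Rightarrow> ('k \<Rightarrow> nat) \<Rightarrow> nat \<Rightarrow> nat \<times> (M2, 'k::comm_ring_1) mpoly set \<Rightarrow> bool" where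
  "system_code K enc c = (\<lambda>(n, F). \<exists>es. set es \<subseteq> mexprs n K \<and> F = mexpr_poly ` set es \<and>
     c = prod_encode (n, list_encode (map (mexpr_code enc) es)))"

lemma mexpr_poly_surj:
  assumes p: "p \<in> mpolys n K"
  shows "\<exists>e\<in>mexprs n K. mexpr_poly e = p"
proof -
  have mon: "\<exists>vs. set vs \<subseteq> A \<and> (\<Prod>v\<leftarrow>vs. Indet v) = (\<Prod>v\<in>A. Indet v ^ e v :: (M2, 'a) mpoly)"
    if "finite A" for A and e :: "nat \<times> M2 \<Rightarrow> nat"
    using that
  proof (induction A rule: finite_induct)
    case empty
    show ?case by (rule exI[of _ "[]"]) simp
  next
    case (insert v A)
    then obtain vs where "set vs \<subseteq> A"
      "(\<Prod>v\<leftarrow>vs. Indet v) = (\<Prod>v\<in>A. Indet v ^ e v :: (M2, 'a) mpoly)" by blast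
    with insert.hyps show ?case
      by (intro exI[of _ "replicate (e v) v @ vs"]) (auto simp: prod_list_replicate)
  qed
  have "\<forall>t. \<exists>vs. set vs \<subseteq> Poly_Mapping.keys t \<and> (\<Prod>v\<leftarrow>vs. Indet v) =
      (\<Prod>v\<in>Poly_Mapping.keys t. Indet v ^ Poly_Mapping.lookup t v :: (M2, 'a) mpoly)"
    using mon[OF finite_keys] by blast
  then obtain vs where vs: "\<And>t. set (vs t) \<subseteq> Poly_Mapping.keys t"
    "\<And>t. (\<Prod>v\<leftarrow>vs t. Indet v) =
      (\<Prod>v\<in>Poly_Mapping.keys t. Indet v ^ Poly_Mapping.lookup t v :: (M2, 'a) mpoly)"
    unfolding choice_iff by blast
  obtain ts where ts: "set ts = Poly_Mapping.keys p" "distinct ts"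
    using finite_distinct_list[OF finite_keys[of p]] by blast
  let ?e = "map (\<lambda>t. (Poly_Mapping.lookup p t, vs t)) ts"
  have "?e \<in> mexprs n K"
  proof -
    have "Poly_Mapping.lookup p t \<in> K \<and> (\<forall>(i, m)\<in>set (vs t). i < n)" if "t \<in> set ts" for t
      using that p vs(1)[of t] unfolding ts(1) mpolys_def by blast
    then show ?thesis
      by (simp add: mexprs_def)
  qed
  moreover have "mexpr_poly ?e = mpoly_subst Const Indet p"
    using ts by (simp add: mexpr_poly_def mpoly_subst_def vs(2) o_def sum_list_distinct_conv_sum_set)
  ultimately show ?thesis
    unfolding subst_Const_Indet by blast
qed

lemma system_code_exists:
  assumes "finite F" "F \<subseteq> mpolys n K"
  shows "\<exists>c. system_code K enc c (n, F)"
proof -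
  have "F \<subseteq> mexpr_poly ` mexprs n K"
    using assms(2) mexpr_poly_surj by blast
  then obtain E where E: "E \<subseteq> mexprs n K" "finite E" "F = mexpr_poly ` E"
    using finite_subset_image[OF assms(1)] by blast
  obtain es where "set es = E"
    using finite_list[OF E(2)] by blast
  with E show ?thesis
    unfolding system_code_def by blast
qed

lemma inj_word_code: "inj word_code"
proof (rule injI)
  fix u v assume "word_code u = word_code v"
  moreover have "inj (map (of_bool :: bool \<Rightarrow> nat))"
    by (intro inj_mapI injI) (auto split: if_splits simp: of_bool_def)
  ultimately show "u = v"
    by (auto simp: word_code_def list_encode_eq dest: injD intro: free_monoid.expand)
qed

lemma inj_indet_code: "inj indet_code"
  using inj_word_code by (auto simp: indet_code_def inj_def)

lemma term_code_inj:
  assumes "inj_on enc K" "a \<in> K" "b \<in> K" "term_code enc (a, vs) = term_code enc (b, ws)"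
  shows "a = b \<and> vs = ws"
  using assms inj_mapI[OF inj_indet_code]
  by (auto simp: term_code_def list_encode_eq dest: inj_onD injD)

lemma mexpr_code_inj:
  assumes enc: "inj_on enc K" and e: "e \<in> mexprs n K" "e' \<in> mexprs n' K"
    and eq: "mexpr_code enc e = mexpr_code enc e'"
  shows "e = e'"
proof -
  have "map (term_code enc) e = map (term_code enc) e'"
    using eq by (simp add: mexpr_code_def list_encode_eq)
  moreover have "inj_on (term_code enc) (set e \<union> set e')"
  proof (rule inj_onI)
    fix s t assume st: "s \<in> set e \<union> set e'" "t \<in> set e \<union> set e'" "term_code enc s = term_code enc t"
    then have "fst s \<in> K" "fst t \<in> K"
      using e by (auto simp: mexprs_def)
    with term_code_inj[OF enc, of "fst s" "fst t" "snd s" "snd t"] st(3) show "s = t"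
      by (simp add: prod_eq_iff)
  qed
  ultimately show ?thesis
    using map_inj_on by blast
qed

lemma system_code_unique:
  assumes "inj_on enc K" "system_code K enc c (n, F)" "system_code K enc c (n', F')"
  shows "n = n' \<and> F = F'"
proof -
  obtain es es' where es: "set es \<subseteq> mexprs n K" "F = mexpr_poly ` set es"
    and es': "set es' \<subseteq> mexprs n' K" "F' = mexpr_poly ` set es'"
    and eq: "prod_encode (n, list_encode (map (mexpr_code enc) es)) =
      prod_encode (n', list_encode (map (mexpr_code enc) es'))"
    using assms(2,3) by (auto simp: system_code_def)
  from eq have "n = n'" and "map (mexpr_code enc) es = map (mexpr_code enc) es'"
    by (simp_all add: list_encode_eq)
  moreover have "inj_on (mexpr_code enc) (set es \<union> set es')"
  proof (rule inj_onI)
    fix e e' assume "e \<in> set es \<union> set es'" "e' \<in> set es \<union> set es'"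
      "mexpr_code enc e = mexpr_code enc e'"
    with es(1) es'(1) \<open>n = n'\<close> show "e = e'"
      using mexpr_code_inj[OF assms(1)] by blast
  qed
  ultimately show ?thesis
    using map_inj_on es(2) es'(2) by blast
qed

end

theory Submission
  imports Defs
begin

text \<open>
  The Cayley graph of \<open>M\<^sub>2\<close> is a binary tree, and a system of equations is a local condition on a
  labelling of its nodes. Such a condition can force the evaluation of any recursive function at
  given arguments: one generator passes the arguments of a call on to a fresh computation, and the
  other one performs a step of a primitive recursion or of an unbounded search. Case distinctions
  on whether a value vanishes are polynomial with an auxiliary inverse, since \<open>k\<close> is a field.
  Requiring the computed value to be \<open>0\<close> turns a halting computation into a system that is solvable
  if and only if its value is \<open>0\<close>.

  If \<open>f\<close> decided solvability, let \<open>S p\<close> be the code of the system that consists of the equations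
  coded by \<open>p\<close> and of the input \<open>p\<close>. For the equations \<open>p\<close> that express \<open>f (S c) = 0\<close> at the input
  \<open>c\<close>, the system \<open>S p\<close> is solvable if and only if \<open>f\<close> declares it to be unsolvable.
\<close>

section \<open>Definable relations between sequences\<close>

text \<open>An infinite family \<open>X\<close> replaces the list of solutions, so no number of
  variables has to be carried along. The value at \<open>l\<close> involves \<open>X\<close> only at
  the nodes \<open>l * m\<close>.\<close>

definition mexpr_val :: "(nat \<Rightarrow> M2 \<Rightarrow> 'k::comm_ring_1) \<Rightarrow> 'k mexpr \<Rightarrow> M2 \<Rightarrow> 'k" where
  "mexpr_val X e l = (\<Sum>(a, vs)\<leftarrow>e. a * (\<Prod>(i, m)\<leftarrow>vs. X i (l * m)))"

lemma mpoly_eval_mexpr_poly: "mpoly_eval xs (mexpr_poly e) = mexpr_val ((!) xs) e"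
proof -
  have prod: "mpoly_eval xs (\<Prod>v\<leftarrow>vs. Indet v) l = (\<Prod>(i, m)\<leftarrow>vs. (xs ! i) (l * m))" for vs l
  proof (induction vs)
    case Nil
    show ?case by (simp add: mpoly_eval_def const_seq.subst_1)
  qed (auto simp: mpoly_eval_mult mpoly_eval_Indet seq_shift_def)
  show ?thesis
  proof
    fix l
    show "mpoly_eval xs (mexpr_poly e) l = mexpr_val ((!) xs) e l"
    proof (induction e)
      case Nil
      show ?case by (simp add: mexpr_poly_def mexpr_val_def mpoly_eval_def const_seq.subst_0)
    qed (auto simp: mexpr_poly_def mexpr_val_def mpoly_eval_add mpoly_eval_mult mpoly_eval_Const
          const_seq_def prod)
  qed
qed

definition mexpr_rename :: "(nat \<Rightarrow> nat) \<Rightarrow> 'k mexpr \<Rightarrow> 'k mexpr" where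
  "mexpr_rename \<rho> e = map (\<lambda>(a, vs). (a, map (\<lambda>(i, m). (\<rho> i, m)) vs)) e"

lemma mexpr_val_rename: "mexpr_val X (mexpr_rename \<rho> e) = mexpr_val (\<lambda>i. X (\<rho> i)) e"
proof -
  have prod: "(\<Prod>(i, m)\<leftarrow>map (\<lambda>(i, m). (\<rho> i, m)) vs. X i (l * m)) = (\<Prod>(i, m)\<leftarrow>vs. X (\<rho> i) (l * m))"
    for vs and l
    by (induction vs) auto
  show ?thesis
  proof
    fix l
    show "mexpr_val X (mexpr_rename \<rho> e) l = mexpr_val (\<lambda>i. X (\<rho> i)) e l"
      by (induction e) (auto simp: mexpr_val_def mexpr_rename_def prod simp del: map_map)
  qed
qed

lemma fst_mexpr_rename [simp]: "fst ` set (mexpr_rename \<rho> e) = fst ` set e"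
  by (force simp: mexpr_rename_def image_def)

text \<open>Interleaving packs two infinite families of variables into one, and families separated
  in this way never share a name.\<close>

definition join :: "(nat \<Rightarrow> 'a) \<Rightarrow> (nat \<Rightarrow> 'a) \<Rightarrow> nat \<Rightarrow> 'a" where
  "join X Y i = (if even i then X (i div 2) else Y (i div 2))"

lemma join_simps [simp]: "join X Y (2 * i) = X i" "join X Y (Suc (2 * i)) = Y i"
  by (simp_all add: join_def)

lemma join_split: "join (\<lambda>i. W (2 * i)) (\<lambda>i. W (Suc (2 * i))) = W"
  by (auto simp: join_def fun_eq_iff elim: evenE oddE)

section \<open>Polynomial functions of sequences with coefficients in \<open>K\<close>\<close>

locale coeff_field =
  fixes K :: "'k::field_char_0 set"
  assumes subfield: "is_subfield K"
begin

lemma of_nat_in_K: "of_nat n \<in> K"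
  using subfield by (induction n) (auto simp: is_subfield_def)

definition local_fun :: "((nat \<Rightarrow> M2 \<Rightarrow> 'k) \<Rightarrow> M2 \<Rightarrow> 'k) \<Rightarrow> bool" where
  "local_fun g \<longleftrightarrow> (\<exists>e. fst ` set e \<subseteq> K \<and> (\<forall>X l. mexpr_val X e l = g X l))"

lemma local_const: "a \<in> K \<Longrightarrow> local_fun (\<lambda>X l. a)"
  unfolding local_fun_def by (rule exI[of _ "[(a, [])]"]) (simp add: mexpr_val_def)

lemma local_var_shift: "local_fun (\<lambda>X l. X i (l * m))"
  unfolding local_fun_def using of_nat_in_K[of 1]
  by (intro exI[of _ "[(1, [(i, m)])]"]) (simp add: mexpr_val_def)

lemma local_var: "local_fun (\<lambda>X l. X i l)"
  using local_var_shift[of i 1] by simp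

lemma local_add:
  assumes "local_fun g" "local_fun h"
  shows "local_fun (\<lambda>X l. g X l + h X l)"
proof -
  obtain d where "fst ` set d \<subseteq> K" "\<And>X l. mexpr_val X d l = g X l"
    using assms(1) unfolding local_fun_def by blast
  moreover obtain e where "fst ` set e \<subseteq> K" "\<And>X l. mexpr_val X e l = h X l"
    using assms(2) unfolding local_fun_def by blast
  ultimately show ?thesis
    unfolding local_fun_def by (intro exI[of _ "d @ e"]) (auto simp: mexpr_val_def)
qed

lemma local_mult:
  assumes "local_fun g" "local_fun h"
  shows "local_fun (\<lambda>X l. g X l * h X l)"
proof -
  obtain d where d: "fst ` set d \<subseteq> K" "\<And>X l. mexpr_val X d l = g X l"
    using assms(1) unfolding local_fun_def by blast
  obtain e where e: "fst ` set e \<subseteq> K" "\<And>X l. mexpr_val X e l = h X l"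
    using assms(2) unfolding local_fun_def by blast
  \<comment> \<open>Multiplication of \<open>e\<close> by a single term; the product is the
    concatenation of these over the terms of \<open>d\<close>. Equal monomials need not be
    collected, since expressions allow repetitions.\<close>
  define scale where "scale = (\<lambda>(a, vs). map (\<lambda>(b, ws). (a * b, vs @ ws)) e)"
  have scale: "mexpr_val X (scale (a, vs)) l = a * (\<Prod>(i, m)\<leftarrow>vs. X i (l * m)) * mexpr_val X e l"
    for a vs X l
    by (simp only: scale_def mexpr_val_def prod.case, induction e) (auto simp: distrib_left)
  have append: "mexpr_val X (c @ d) l = mexpr_val X c l + mexpr_val X d l" for X l and c d :: "'k mexpr"
    by (simp add: mexpr_val_def)
  have val: "mexpr_val X (concat (map scale d)) l = mexpr_val X d l * mexpr_val X e l" for X l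
  proof (induction d)
    case (Cons t d)
    have "mexpr_val X (t # d) l = fst t * (\<Prod>(i, m)\<leftarrow>snd t. X i (l * m)) + mexpr_val X d l"
      by (simp add: mexpr_val_def case_prod_beta)
    with Cons.IH scale[of X "fst t" "snd t" l] show ?case
      by (simp add: append distrib_right)
  qed (simp add: mexpr_val_def)
  have "fst ` set (concat (map scale d)) \<subseteq> K"
  proof
    fix x assume "x \<in> fst ` set (concat (map scale d))"
    then obtain a vs b ws where "(a, vs) \<in> set d" "(b, ws) \<in> set e" "x = a * b"
      by (auto simp: scale_def)
    moreover from this have "a \<in> K" "b \<in> K"
      using d(1) e(1) by force+
    ultimately show "x \<in> K"
      using subfield by (simp add: is_subfield_def)
  qed
  with val d(2) e(2) show ?thesis
    unfolding local_fun_def by (intro exI[of _ "concat (map scale d)"]) simp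
qed

lemma local_diff:
  assumes "local_fun g" "local_fun h"
  shows "local_fun (\<lambda>X l. g X l - h X l)"
proof -
  have "- 1 \<in> K"
    using subfield by (simp add: is_subfield_def)
  from local_add[OF assms(1) local_mult[OF local_const[OF this] assms(2)]] show ?thesis
    by simp
qed

lemma local_reindex:
  assumes "local_fun g"
  shows "local_fun (\<lambda>X. g (\<lambda>i. X (\<rho> i)))"
proof -
  obtain e where "fst ` set e \<subseteq> K" "\<And>X l. mexpr_val X e l = g X l"
    using assms unfolding local_fun_def by blast
  then show ?thesis
    unfolding local_fun_def
    by (intro exI[of _ "mexpr_rename \<rho> e"]) (simp add: mexpr_val_rename)
qed

lemma local_0: "local_fun (\<lambda>X l. 0)" and local_1: "local_fun (\<lambda>X l. 1)"
  using local_const[OF of_nat_in_K[of 0]] local_const[OF of_nat_in_K[of 1]] by simp_all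

lemmas local_intros =
  local_0 local_1 local_var local_var_shift local_add local_mult local_diff

text \<open>
  The even variables are the parameters and the odd ones are existentially quantified. Both kinds
  are infinite in supply, so that no fresh names have to be managed.
\<close>

definition definable :: "((nat \<Rightarrow> M2 \<Rightarrow> 'k) \<Rightarrow> bool) \<Rightarrow> bool" where
  "definable P \<longleftrightarrow> (\<exists>es. (\<forall>e\<in>set es. fst ` set e \<subseteq> K) \<and>
     (\<forall>X. P X \<longleftrightarrow> (\<exists>Y. \<forall>e\<in>set es. \<forall>l. mexpr_val (join X Y) e l = 0)))"

section \<open>Closure properties of definable relations\<close>

lemma definable_True: "definable (\<lambda>X. True)"
  unfolding definable_def by (rule exI[of _ "[]"]) simp

lemma definable_eq:
  assumes "local_fun g" "local_fun h"
  shows "definable (\<lambda>X. \<forall>l. g X l = h X l)"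
proof -
  obtain e where e: "fst ` set e \<subseteq> K" "\<And>X l. mexpr_val X e l = g X l - h X l"
    using local_diff[OF assms] unfolding local_fun_def by blast
  have "mexpr_val (join X Y) (mexpr_rename ((*) 2) e) l = g X l - h X l" for X Y l
    by (simp add: mexpr_val_rename e(2))
  with e(1) show ?thesis
    unfolding definable_def by (intro exI[of _ "[mexpr_rename ((*) 2) e]"]) simp
qed

lemma definable_conj:
  assumes "definable P" "definable Q"
  shows "definable (\<lambda>X. P X \<and> Q X)"
proof -
  obtain d where d: "\<forall>e\<in>set d. fst ` set e \<subseteq> K"
      "\<And>X. P X \<longleftrightarrow> (\<exists>Y. \<forall>e\<in>set d. \<forall>l. mexpr_val (join X Y) e l = 0)"
    using assms(1) unfolding definable_def by blast
  obtain e where e: "\<forall>e\<in>set e. fst ` set e \<subseteq> K"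
      "\<And>X. Q X \<longleftrightarrow> (\<exists>Y. \<forall>e\<in>set e. \<forall>l. mexpr_val (join X Y) e l = 0)"
    using assms(2) unfolding definable_def by blast
  \<comment> \<open>Both renamings fix the parameters. The witnesses for \<open>P\<close> go to the
    even-numbered witness variables and those for \<open>Q\<close> to the odd-numbered ones, so they
    can be chosen independently.\<close>
  define \<rho> \<tau> :: "nat \<Rightarrow> nat"
    where "\<rho> = join ((*) 2) (\<lambda>j. Suc (2 * (2 * j)))"
      and "\<tau> = join ((*) 2) (\<lambda>j. Suc (2 * Suc (2 * j)))"
  have \<rho>: "(\<lambda>i. join X Y (\<rho> i)) = join X (\<lambda>i. Y (2 * i))"
    and \<tau>: "(\<lambda>i. join X Y (\<tau> i)) = join X (\<lambda>i. Y (Suc (2 * i)))" for X Y :: "nat \<Rightarrow> M2 \<Rightarrow> 'k"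
    by (auto simp: \<rho>_def \<tau>_def fun_eq_iff join_def)
  let ?es = "map (mexpr_rename \<rho>) d @ map (mexpr_rename \<tau>) e"
  have "P X \<and> Q X \<longleftrightarrow> (\<exists>Y. \<forall>e\<in>set ?es. \<forall>l. mexpr_val (join X Y) e l = 0)" for X
  proof
    assume "P X \<and> Q X"
    then obtain Y Z where "\<forall>e\<in>set d. \<forall>l. mexpr_val (join X Y) e l = 0"
      "\<forall>e\<in>set e. \<forall>l. mexpr_val (join X Z) e l = 0"
      unfolding d(2) e(2) by blast
    then show "\<exists>Y. \<forall>e\<in>set ?es. \<forall>l. mexpr_val (join X Y) e l = 0"
      by (intro exI[of _ "join Y Z"]) (auto simp: mexpr_val_rename \<rho> \<tau>)
  next
    assume "\<exists>Y. \<forall>e\<in>set ?es. \<forall>l. mexpr_val (join X Y) e l = 0"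
    then obtain Y where "\<forall>e\<in>set ?es. \<forall>l. mexpr_val (join X Y) e l = 0" by blast
    then have "\<forall>e\<in>set d. \<forall>l. mexpr_val (join X (\<lambda>i. Y (2 * i))) e l = 0"
      "\<forall>e\<in>set e. \<forall>l. mexpr_val (join X (\<lambda>i. Y (Suc (2 * i)))) e l = 0"
      by (auto simp: ball_Un mexpr_val_rename \<rho> \<tau>)
    then show "P X \<and> Q X"
      unfolding d(2) e(2) by blast
  qed
  with d(1) e(1) show ?thesis
    unfolding definable_def by (intro exI[of _ ?es]) (simp add: ball_Un)
qed

text \<open>Only the parameters are renamed; the witness variables stay in place.\<close>

lemma definable_reindex:
  assumes "definable P"
  shows "definable (\<lambda>X. P (\<lambda>i. X (\<rho> i)))"
proof -
  obtain es where es: "\<forall>e\<in>set es. fst ` set e \<subseteq> K"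
      "\<And>X. P X \<longleftrightarrow> (\<exists>Y. \<forall>e\<in>set es. \<forall>l. mexpr_val (join X Y) e l = 0)"
    using assms unfolding definable_def by blast
  define \<tau> where "\<tau> = join (\<lambda>j. 2 * \<rho> j) (\<lambda>j. Suc (2 * j))"
  have \<tau>: "(\<lambda>i. join X Y (\<tau> i)) = join (\<lambda>i. X (\<rho> i)) Y" for X Y :: "nat \<Rightarrow> M2 \<Rightarrow> 'k"
    by (auto simp: \<tau>_def fun_eq_iff join_def)
  show ?thesis
    unfolding definable_def
    by (intro exI[of _ "map (mexpr_rename \<tau>) es"]) (simp add: es mexpr_val_rename \<tau>)
qed

lemma definable_reindex_if:
  assumes "definable P"
  shows "definable (\<lambda>X. P (\<lambda>i. if i = 0 then X n else X (\<rho> i)))"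
  using definable_reindex[OF assms, of "\<lambda>i. if i = 0 then n else \<rho> i"] by (simp add: if_distrib)

text \<open>A whole infinite family is quantified at once. The premise views \<open>X\<close> and
  \<open>Z\<close> as the even and odd parts of one parameter family \<open>W\<close>; the renaming
  then turns \<open>Z\<close> into witnesses.\<close>

lemma definable_ex:
  assumes "definable (\<lambda>W. Q (\<lambda>i. W (2 * i)) (\<lambda>i. W (Suc (2 * i))))"
  shows "definable (\<lambda>X. \<exists>Z. Q X Z)"
proof -
  obtain es where es: "\<forall>e\<in>set es. fst ` set e \<subseteq> K"
      "\<And>W. Q (\<lambda>i. W (2 * i)) (\<lambda>i. W (Suc (2 * i))) \<longleftrightarrow>
        (\<exists>Y. \<forall>e\<in>set es. \<forall>l. mexpr_val (join W Y) e l = 0)"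
    using assms unfolding definable_def by blast
  have Q: "Q X Z \<longleftrightarrow> (\<exists>Y. \<forall>e\<in>set es. \<forall>l. mexpr_val (join (join X Z) Y) e l = 0)" for X Z
    using es(2)[of "join X Z"] by simp
  define \<tau> :: "nat \<Rightarrow> nat" where
    "\<tau> = join (join ((*) 2) (\<lambda>j. Suc (2 * (2 * j)))) (\<lambda>j. Suc (2 * Suc (2 * j)))"
  have \<tau>: "(\<lambda>i. join X Y (\<tau> i)) = join (join X (\<lambda>i. Y (2 * i))) (\<lambda>i. Y (Suc (2 * i)))"
    for X Y :: "nat \<Rightarrow> M2 \<Rightarrow> 'k"
    by (auto simp: \<tau>_def fun_eq_iff join_def)
  have "(\<exists>Z. Q X Z) \<longleftrightarrow>
      (\<exists>Y. \<forall>e\<in>set (map (mexpr_rename \<tau>) es). \<forall>l. mexpr_val (join X Y) e l = 0)" for X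
  proof
    assume "\<exists>Z. Q X Z"
    then obtain Z Y where "\<forall>e\<in>set es. \<forall>l. mexpr_val (join (join X Z) Y) e l = 0"
      unfolding Q by blast
    then show "\<exists>Y. \<forall>e\<in>set (map (mexpr_rename \<tau>) es). \<forall>l. mexpr_val (join X Y) e l = 0"
      by (intro exI[of _ "join Z Y"]) (simp add: mexpr_val_rename \<tau>)
  qed (auto simp: Q mexpr_val_rename \<tau>)
  with es(1) show ?thesis
    unfolding definable_def by (intro exI[of _ "map (mexpr_rename \<tau>) es"]) simp
qed

lemma definable_all_less:
  assumes "\<And>j. j < n \<Longrightarrow> definable (P j)"
  shows "definable (\<lambda>X. \<forall>j<n::nat. P j X)"
proof -
  have "definable (\<lambda>X. \<forall>j<m. P j X)" if "m \<le> n" for m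
    using that
  proof (induction m)
    case (Suc m)
    with definable_conj[OF Suc.IH assms[of m]] show ?case
      by (simp add: All_less_Suc conj_commute)
  qed (simp add: definable_True)
  then show ?thesis
    by simp
qed

lemma definable_if_zero:
  assumes "local_fun f" "local_fun g" "local_fun h" "local_fun r"
  shows "definable (\<lambda>X. \<forall>l. f X l = (if g X l = 0 then h X l else r X l))"
proof -
  \<comment> \<open>The equations force \<open>Z 0\<close> to be the indicator of
    \<open>g X l = 0\<close>: the first makes it 0 where \<open>g\<close> does not vanish, the
    second makes it 1 where \<open>g\<close> does. \<open>Z 1\<close> is the auxiliary
    inverse.\<close>
  have "definable (\<lambda>X. \<exists>Z::nat \<Rightarrow> M2 \<Rightarrow> 'k. (\<forall>l. Z 0 l * g X l = 0) \<and> (\<forall>l. Z 0 l + g X l * Z 1 l = 1) \<and>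
      (\<forall>l. f X l = Z 0 l * h X l + (1 - Z 0 l) * r X l))" (is "definable ?P")
    by (intro definable_ex definable_conj definable_eq local_intros assms[THEN local_reindex])
  moreover have "?P X \<longleftrightarrow> (\<forall>l. f X l = (if g X l = 0 then h X l else r X l))" (is "_ \<longleftrightarrow> ?R") for X
  proof
    assume "?P X"
    then obtain Z :: "nat \<Rightarrow> M2 \<Rightarrow> 'k"
      where Z: "\<And>l. Z 0 l * g X l = 0" "\<And>l. Z 0 l + g X l * Z 1 l = 1"
      "\<And>l. f X l = Z 0 l * h X l + (1 - Z 0 l) * r X l" by blast
    show ?R
    proof
      fix l
      show "f X l = (if g X l = 0 then h X l else r X l)"
        using Z(1,2,3)[of l] by auto
    qed
  next
    assume ?R
    then show "?P X"
      by (intro exI[of _ "\<lambda>i l. if i = 0 then of_bool (g X l = 0) else inverse (g X l)"]) auto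
  qed
  ultimately show ?thesis
    by simp
qed

end


section \<open>Recursive functions as definable relations\<close>

abbreviation "gen_a \<equiv> Word [False]"
abbreviation "gen_b \<equiv> Word [True]"

text \<open>
  Every node \<open>l\<close> of the tree starts a computation at its child \<open>l * gen_b\<close>, which then proceeds
  along the children by \<open>gen_a\<close>. Since every node other than the root is a child in one way only,
  infinitely many computations fit into the tree without a conflict.
\<close>

lemma tree_recursion:
  fixes s :: "M2 \<Rightarrow> 'c" and h :: "'c \<Rightarrow> 'c"
  obtains t where "\<And>l. t (l * gen_b) = s l" "\<And>l. t (l * gen_a) = h (t l)"
proof
  \<comment> \<open>Reversal puts the last letter first, which tells by which generator the node was
    reached. Neither equation prescribes a value at the root, so \<open>s 1\<close> there is an
    arbitrary choice.\<close>
  define t where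
    "t l = rec_list (s 1) (\<lambda>x ys r. if x then s (Word (rev ys)) else h r) (rev (letters l))" for l
  show "t (l * gen_b) = s l" "t (l * gen_a) = h (t l)" for l
    by (simp_all add: t_def times_free_monoid_def)
qed

definition search_from :: "(nat \<Rightarrow> nat) \<Rightarrow> nat \<Rightarrow> nat" where
  "search_from F n = (if \<exists>m\<ge>n. F m = 0 then LEAST m. m \<ge> n \<and> F m = 0 else 0)"

text \<open>If no zero is found, both sides are the default 0. Hence this equation can be imposed at
  every node, whether or not the search succeeds.\<close>

lemma search_from_step: "search_from F n = (if F n = 0 then n else search_from F (Suc n))"
proof (cases "F n = 0")
  case True
  then have "(LEAST m. m \<ge> n \<and> F m = 0) = n"
    by (intro Least_equality) auto
  with True show ?thesis
    by (auto simp: search_from_def)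
next
  case False
  then have "n \<le> m \<and> F m = 0 \<longleftrightarrow> Suc n \<le> m \<and> F m = 0" for m
    by (metis le_eq_less_or_eq Suc_le_eq)
  then show ?thesis
    unfolding search_from_def using False by (simp only: if_False)
qed

text \<open>
  A solution has to label also those nodes whose inputs lie outside the domain of a partial
  recursive function; there it uses the values of the following total extension.
\<close>

primrec total_value :: "recf \<Rightarrow> (nat \<Rightarrow> nat) \<Rightarrow> nat" where
  "total_value Zero = (\<lambda>N. 0)"
| "total_value Succ = (\<lambda>N. Suc (N 0))"
| "total_value (Proj i) = (\<lambda>N. N i)"
| "total_value (Comp f gs) =
    (\<lambda>N. total_value f (\<lambda>j. if j < length gs then (map total_value gs ! j) N else 0))"
| "total_value (PrimRec f g) = (\<lambda>N. rec_nat (total_value f (\<lambda>j. N (Suc j)))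
    (\<lambda>n y. total_value g (case_nat n (case_nat y (\<lambda>j. N (Suc j))))) (N 0))"
| "total_value (Mu f) = (\<lambda>N. search_from (\<lambda>n. total_value f (case_nat n N)) 0)"

context coeff_field
begin

text \<open>
  Variable \<open>0\<close> is the output and the variables from \<open>1\<close> on are the inputs, of which only the first
  \<open>m\<close> matter.
\<close>

definition sound :: "nat \<Rightarrow> recf \<Rightarrow> ((nat \<Rightarrow> M2 \<Rightarrow> 'k) \<Rightarrow> bool) \<Rightarrow> bool" where
  "sound m f P \<longleftrightarrow> (\<forall>X l xs y. P X \<longrightarrow> computes f xs y \<longrightarrow> length xs = m \<longrightarrow>
     (\<forall>j<m. X (Suc j) l = of_nat (xs ! j)) \<longrightarrow> X 0 l = of_nat y)"

text \<open>Soundness speaks of a single node with a halting input. Completeness must label all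
  nodes at once, including those where nothing halts, and so uses \<open>total_value\<close> rather
  than \<open>computes\<close>.\<close>

definition complete :: "recf \<Rightarrow> ((nat \<Rightarrow> M2 \<Rightarrow> 'k) \<Rightarrow> bool) \<Rightarrow> bool" where
  "complete f P \<longleftrightarrow> (\<forall>N. (\<forall>l. N 0 l = total_value f (\<lambda>j. N (Suc j) l)) \<longrightarrow>
     P (\<lambda>i l. of_nat (N i l)))"

lemma soundD:
  assumes "sound m f P" "P X" "computes f xs y" "length xs = m"
    "\<And>j. j < m \<Longrightarrow> X (Suc j) l = of_nat (xs ! j)"
  shows "X 0 l = of_nat y"
  using assms unfolding sound_def by blast

lemma completeD:
  assumes "complete f P" "\<And>l. N 0 l = total_value f (\<lambda>j. N (Suc j) l)"
  shows "P (\<lambda>i l. of_nat (N i l))"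
  using assms unfolding complete_def by blast

definition realizes :: "nat \<Rightarrow> recf \<Rightarrow> ((nat \<Rightarrow> M2 \<Rightarrow> 'k) \<Rightarrow> bool) \<Rightarrow> bool" where
  "realizes m f P \<longleftrightarrow> definable P \<and> sound m f P \<and> complete f P"

section \<open>Systems for the individual schemes of recursion\<close>

lemma realizes_Zero: "realizes m Zero (\<lambda>X. \<forall>l. X 0 l = 0)"
  unfolding realizes_def sound_def complete_def
  by (auto intro!: definable_eq local_intros elim: computes_cases)

lemma realizes_Succ: "realizes m Succ (\<lambda>X. \<forall>l. X 0 l = X 1 l + 1)"
  unfolding realizes_def sound_def complete_def
  by (auto intro!: definable_eq local_intros elim!: computes_cases)

lemma realizes_Proj: "realizes m (Proj i) (\<lambda>X. \<forall>l. X 0 l = X (Suc i) l)"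
  unfolding realizes_def sound_def complete_def
  by (auto intro!: definable_eq local_intros elim!: computes_cases)

text \<open>All values live at the same node, so no recursion along the tree is needed. The inputs
  in \<open>Z\<close> are the intermediate results; each \<open>Q j\<close> reads the inputs in
  \<open>X\<close> and has its output redirected to \<open>Z (Suc j)\<close>.\<close>

lemma realizes_Comp:
  assumes f: "realizes (length gs) f P"
    and g: "\<And>j. j < length gs \<Longrightarrow> realizes m (gs ! j) (Q j)"
  shows "realizes m (Comp f gs) (\<lambda>X. \<exists>Z. P Z \<and> (\<forall>l. X 0 l = Z 0 l) \<and>
    (\<forall>j<length gs. Q j (\<lambda>i. if i = 0 then Z (Suc j) else X i)))" (is "realizes _ _ ?R")
  unfolding realizes_def
proof (intro conjI)
  have dP: "definable P" and dQ: "\<And>j. j < length gs \<Longrightarrow> definable (Q j)"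
    using f g by (auto simp: realizes_def)
  show "definable ?R"
    by (rule definable_ex definable_conj definable_eq local_intros dP[THEN definable_reindex]
        definable_all_less dQ[THEN definable_reindex_if] | assumption)+
  show "sound m (Comp f gs) ?R"
    unfolding sound_def
  proof (intro allI impI)
    fix X l xs y
    assume "?R X" and c: "computes (Comp f gs) xs y" and xs: "length xs = m"
      "\<forall>j<m. X (Suc j) l = of_nat (xs ! j)"
    then obtain Z where Z: "P Z" "\<And>l. X 0 l = Z 0 l"
      "\<And>j. j < length gs \<Longrightarrow> Q j (\<lambda>i. if i = 0 then Z (Suc j) else X i)" by blast
    obtain ys where ys: "list_all2 (\<lambda>g y. computes g xs y) gs ys" "computes f ys y"
      using c by (rule computes_cases)
    have len: "length ys = length gs"
      using ys(1) by (simp add: list_all2_lengthD)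
    have "Z (Suc j) l = of_nat (ys ! j)" if "j < length gs" for j
      using soundD[of m "gs ! j" "Q j" _ xs "ys ! j" l, OF _ Z(3)[OF that]] g[OF that] xs ys(1) that
      by (simp add: realizes_def list_all2_conv_all_nth)
    then show "X 0 l = of_nat y"
      using f Z(1,2) ys(2) len soundD[of "length gs" f P Z ys y l] by (simp add: realizes_def)
  qed
  show "complete (Comp f gs) ?R"
    unfolding complete_def
  proof (intro allI impI)
    fix N :: "nat \<Rightarrow> M2 \<Rightarrow> nat"
    assume N: "\<forall>l. N 0 l = total_value (Comp f gs) (\<lambda>j. N (Suc j) l)"
    \<comment> \<open>The default 0 beyond the length of \<open>gs\<close> matches the clause of
      \<open>total_value\<close> for compositions.\<close>
    define Z where "Z = case_nat (N 0) (\<lambda>j l. if j < length gs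
      then total_value (gs ! j) (\<lambda>i. N (Suc i) l) else 0)"
    have "P (\<lambda>i l. of_nat (Z i l))"
      using f N by (intro completeD[of f P]) (auto simp: realizes_def Z_def cong: if_cong)
    moreover have "Q j (\<lambda>i. if i = 0 then (\<lambda>l. of_nat (Z (Suc j) l)) else (\<lambda>l. of_nat (N i l)))"
      if "j < length gs" for j
    proof -
      have "Q j (\<lambda>i l. of_nat ((if i = 0 then Z (Suc j) else N i) l))"
        using g[OF that] that by (intro completeD[of "gs ! j" "Q j"]) (auto simp: realizes_def Z_def)
      moreover have "(\<lambda>i l. of_nat ((if i = 0 then Z (Suc j) else N i) l)) =
          (\<lambda>i. if i = 0 then (\<lambda>l. of_nat (Z (Suc j) l)) else (\<lambda>l. of_nat (N i l)))"
        by auto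
      ultimately show ?thesis by (rule back_subst[of "Q j"])
    qed
    ultimately show "?R (\<lambda>i l. of_nat (N i l))"
      by (intro exI[of _ "\<lambda>i l. of_nat (Z i l)"]) (simp add: Z_def)
  qed
qed

text \<open>
  In the recursion at a node, \<open>V 1\<close> is the recursion argument, \<open>V 0\<close> the value in the base case,
  and \<open>V 2\<close> the result; \<open>Z\<close> lists the output of the step function and its inputs: the predecessor
  of the argument, the result at the predecessor, and the parameters.
\<close>

lemma realizes_PrimRec:
  assumes f: "realizes (m - 1) f P" and g: "realizes (Suc m) g Q"
  shows "realizes m (PrimRec f g) (\<lambda>X. \<exists>Z V :: nat \<Rightarrow> M2 \<Rightarrow> 'k.
    (\<forall>l. V 1 (l * gen_b) = X 1 l) \<and> (\<forall>l. V 1 (l * gen_a) = Z 1 l) \<and>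
    (\<forall>j<m. \<forall>l. Z (j + 3) (l * gen_b) = X (j + 2) l) \<and>
    (\<forall>j<m. \<forall>l. Z (j + 3) (l * gen_a) = Z (j + 3) l) \<and>
    (\<forall>l. Z 1 l = (if V 1 l = 0 then 0 else V 1 l - 1)) \<and> (\<forall>l. Z 2 l = V 2 (l * gen_a)) \<and>
    P (\<lambda>i. if i = 0 then V 0 else Z (i + 2)) \<and> Q Z \<and>
    (\<forall>l. V 2 l = (if V 1 l = 0 then V 0 l else Z 0 l)) \<and> (\<forall>l. X 0 l = V 2 (l * gen_b)))"
    (is "realizes _ _ (\<lambda>X. \<exists>Z V. ?B X Z V)")
  unfolding realizes_def
proof (intro conjI)
  let ?R = "\<lambda>X. \<exists>Z V. ?B X Z V"
  have dP: "definable P" and dQ: "definable Q"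
    using f g by (auto simp: realizes_def)
  show "definable ?R"
    by (rule definable_ex definable_conj definable_if_zero definable_eq local_intros
        dP[THEN definable_reindex_if] definable_all_less dQ[THEN definable_reindex])+
  show "sound m (PrimRec f g) ?R"
    unfolding sound_def
  proof (intro allI impI)
    fix X l xs y
    assume R: "?R X" and c: "computes (PrimRec f g) xs y" and xs: "length xs = m"
      "\<forall>j<m. X (Suc j) l = of_nat (xs ! j)"
    from R obtain Z V where B: "?B X Z V"
      by (elim exE)
    have start: "\<And>l. V 1 (l * gen_b) = X 1 l"
        "\<And>j l. j < m \<Longrightarrow> Z (j + 3) (l * gen_b) = X (j + 2) l" "\<And>l. X 0 l = V 2 (l * gen_b)"
      and step: "\<And>l. V 1 (l * gen_a) = Z 1 l" "\<And>l. Z 2 l = V 2 (l * gen_a)"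
        "\<And>j l. j < m \<Longrightarrow> Z (j + 3) (l * gen_a) = Z (j + 3) l"
        "\<And>l. Z 1 l = (if V 1 l = 0 then 0 else V 1 l - 1)"
        "\<And>l. V 2 l = (if V 1 l = 0 then V 0 l else Z 0 l)"
      and P: "P (\<lambda>i. if i = 0 then V 0 else Z (i + 2))" and Q: "Q Z"
      by (insert B) iprover+
    \<comment> \<open>A halting primitive recursion has a first argument, so \<open>m\<close> is
      positive and \<open>m - 1\<close> is the true number of parameters.\<close>
    obtain n ws where ws: "xs = n # ws"
      using c by cases auto
    with xs(1) have m: "m = Suc (length ws)" by simp
    \<comment> \<open>The induction ranges over all nodes, because the result at \<open>l\<close>
      depends on the child \<open>l * gen_a\<close>, where the argument is smaller by one.\<close>
    have recursion: "V 2 l = of_nat y" if "computes (PrimRec f g) (n # ws) y" "V 1 l = of_nat n"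
      "\<And>j. j < length ws \<Longrightarrow> Z (j + 3) l = of_nat (ws ! j)" for n l y
      using that
    proof (induction n arbitrary: l y)
      case 0
      let ?Y = "\<lambda>i. if i = 0 then V 0 else Z (i + 2)"
      have "?Y 0 l = of_nat y"
      proof (rule soundD[of "length ws" f P ?Y ws])
        show "sound (length ws) f P"
          using f m by (simp add: realizes_def)
        show "computes f ws y"
          using 0(1) by (rule computes_cases)
        show "?Y (Suc j) l = of_nat (ws ! j)"
          if "j < length ws" for j
          using 0(3)[OF that] by (simp add: numeral_2_eq_2 numeral_3_eq_3)
      qed (use P in simp_all)
      with 0(2) show ?case
        by (simp add: step(5))
    next
      case (Suc n)
      from Suc.prems(1) obtain y' where y': "computes (PrimRec f g) (n # ws) y'"
        "computes g (n # y' # ws) y" by (rule computes_cases)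
      have V1: "V 1 l = of_nat n + 1"
        using Suc.prems(2) by simp
      \<comment> \<open>Characteristic zero keeps positive arguments from being mistaken for
        0.\<close>
      have nz: "V 1 l \<noteq> 0"
        using Suc.prems(2) by (simp del: of_nat_Suc)
      have Z1: "Z 1 l = of_nat n"
        using nz V1 step(4)[of l] by simp
      have Z2: "Z 2 l = of_nat y'"
        unfolding step(2)
      proof (rule Suc.IH[OF y'(1)])
        show "V 1 (l * gen_a) = of_nat n"
          by (simp only: step(1) Z1)
        show "Z (j + 3) (l * gen_a) = of_nat (ws ! j)" if "j < length ws" for j
          using step(3)[of j l] Suc.prems(3)[OF that] that m by simp
      qed
      have "Z 0 l = of_nat y"
      proof (rule soundD[of "Suc m" g Q Z "n # y' # ws" y l])
        show "sound (Suc m) g Q"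
          using g by (simp add: realizes_def)
        show "length (n # y' # ws) = Suc m"
          using m by simp
        show "Z (Suc j) l = of_nat ((n # y' # ws) ! j)" if "j < Suc m" for j
        proof -
          consider "j = 0" | "j = 1" | "2 \<le> j" by linarith
          then show ?thesis
          proof cases
            case 3
            then obtain i where "j = 2 + i"
              using le_Suc_ex by blast
            with that m Suc.prems(3)[of i] show ?thesis
              by (simp add: numeral_3_eq_3)
          qed (use Z1 Z2 in \<open>simp_all add: numeral_2_eq_2\<close>)
        qed
      qed (fact Q y'(2))+
      with nz show ?case
        by (simp add: step(5))
    qed
    show "X 0 l = of_nat y"
      unfolding start(3)
    proof (rule recursion[of n])
      show "computes (PrimRec f g) (n # ws) y"
        using c ws by simp
      show "V 1 (l * gen_b) = of_nat n"
        unfolding start(1) using xs(2) ws m by auto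
      show "Z (j + 3) (l * gen_b) = of_nat (ws ! j)" if "j < length ws" for j
        using start(2)[of j l] xs(2)[rule_format, of "Suc j"] that ws m by simp
    qed
  qed
  show "complete (PrimRec f g) ?R"
    unfolding complete_def
  proof (intro allI impI)
    fix N :: "nat \<Rightarrow> M2 \<Rightarrow> nat"
    assume N: "\<forall>l. N 0 l = total_value (PrimRec f g) (\<lambda>j. N (Suc j) l)"
    \<comment> \<open>\<open>t l\<close> is the argument list treated at \<open>l\<close>. Truncated
      subtraction keeps the first argument at 0 once it is reached, so the rest of the infinite path
      is labelled too.\<close>
    obtain t where t: "\<And>l. t (l * gen_b) = (\<lambda>j. N (Suc j) l)"
      "\<And>l. t (l * gen_a) = case_nat (t l 0 - 1) (\<lambda>j. t l (Suc j))"
      using tree_recursion[of "\<lambda>l j. N (Suc j) l" "\<lambda>c. case_nat (c 0 - 1) (\<lambda>j. c (Suc j))"]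
      by blast
    define val where "val l = total_value (PrimRec f g) (t l)" for l
    define Z where "Z = case_nat (\<lambda>l. total_value g (case_nat (t l 0 - 1)
        (case_nat (val (l * gen_a)) (\<lambda>j. t l (Suc j)))))
      (case_nat (\<lambda>l. t l 0 - 1) (case_nat (\<lambda>l. val (l * gen_a)) (\<lambda>j l. t l (Suc j))))"
    define V where "V i l = (if i = 0 then total_value f (\<lambda>j. t l (Suc j)) else
      if i = 1 then t l 0 else val l)" for i :: nat and l
    have Z: "Z 0 l = total_value g (\<lambda>j. Z (Suc j) l)" "Z 1 l = t l 0 - 1" "Z 2 l = val (l * gen_a)"
      "Z (i + 3) l = t l (Suc i)" for i l
    proof -
      have "(\<lambda>j. Z (Suc j) l) =
        case_nat (t l 0 - 1) (case_nat (val (l * gen_a)) (\<lambda>j. t l (Suc j)))"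
        by (auto simp: Z_def fun_eq_iff split: nat.split)
      then show "Z 0 l = total_value g (\<lambda>j. Z (Suc j) l)"
        by (simp add: Z_def)
    qed (simp_all add: Z_def numeral_2_eq_2 numeral_3_eq_3)
    have val_step: "val l = (if t l 0 = 0 then V 0 l else Z 0 l)" for l
      by (cases "t l 0") (simp_all add: val_def V_def Z_def t(2))
    have "P (\<lambda>i l. of_nat (if i = 0 then V 0 l else Z (i + 2) l))"
    proof (rule completeD[of f P])
      have "Z (Suc j + 2) l = t l (Suc j)" for j l
        using Z(4)[of j l] by (simp add: numeral_2_eq_2 numeral_3_eq_3)
      then show "(if 0 = (0::nat) then V 0 l else Z (0 + 2) l) =
        total_value f (\<lambda>j. if Suc j = 0 then V 0 l else Z (Suc j + 2) l)" for l
        by (simp add: V_def)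
    qed (use f in \<open>simp add: realizes_def\<close>)
    moreover have "(\<lambda>i l. of_nat (if i = 0 then V 0 l else Z (i + 2) l)) =
        (\<lambda>i. if i = 0 then (\<lambda>l. of_nat (V 0 l)) else (\<lambda>l. of_nat (Z (i + 2) l)))"
      by auto
    ultimately have P: "P (\<lambda>i. if i = 0 then (\<lambda>l. of_nat (V 0 l)) else (\<lambda>l. of_nat (Z (i + 2) l)))"
      by (rule back_subst[of P])
    have Q: "Q (\<lambda>i l. of_nat (Z i l))"
      using g Z(1) by (intro completeD[of g Q]) (auto simp: realizes_def)
    have V: "V 1 l = t l 0" "V 2 l = val l" for l
      by (simp_all add: V_def)
    let ?X = "\<lambda>i l. of_nat (N i l) :: 'k" and ?Z = "\<lambda>i l. of_nat (Z i l) :: 'k"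
      and ?V = "\<lambda>i l. of_nat (V i l) :: 'k"
    have "?B ?X ?Z ?V"
    proof (intro conjI allI impI)
      show "?V 1 (l * gen_b) = ?X 1 l" "?V 1 (l * gen_a) = ?Z 1 l" for l
        by (simp_all only: V Z t) simp_all
      show "?Z (j + 3) (l * gen_b) = ?X (j + 2) l" "?Z (j + 3) (l * gen_a) = ?Z (j + 3) l" for j l
        by (simp_all only: Z t) simp_all
      show "?Z 1 l = (if ?V 1 l = 0 then 0 else ?V 1 l - 1)" for l
        by (simp only: V Z) (simp add: of_nat_diff)
      show "?Z 2 l = ?V 2 (l * gen_a)" for l
        by (simp only: V Z)
      show "?V 2 l = (if ?V 1 l = 0 then ?V 0 l else ?Z 0 l)" for l
        by (simp only: V) (simp add: val_step[of l])
      show "?X 0 l = ?V 2 (l * gen_b)" for l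
        using N by (simp only: V) (simp add: val_def t(1))
    qed (fact P Q)+
    then show "?R ?X"
      by (intro exI)
  qed
qed

text \<open>
  Here \<open>Z\<close> lists the output of \<open>f\<close>, the candidate under test, and the parameters, and \<open>V 0\<close> is the
  result of the search from that candidate on.
\<close>

lemma realizes_Mu:
  assumes f: "realizes (Suc m) f P"
  shows "realizes m (Mu f) (\<lambda>X. \<exists>Z V :: nat \<Rightarrow> M2 \<Rightarrow> 'k.
    (\<forall>l. Z 1 (l * gen_b) = 0) \<and> (\<forall>l. Z 1 (l * gen_a) = Z 1 l + 1) \<and>
    (\<forall>j<m. \<forall>l. Z (j + 2) (l * gen_b) = X (j + 1) l) \<and>
    (\<forall>j<m. \<forall>l. Z (j + 2) (l * gen_a) = Z (j + 2) l) \<and> P Z \<and>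
    (\<forall>l. V 0 l = (if Z 0 l = 0 then Z 1 l else V 0 (l * gen_a))) \<and>
    (\<forall>l. X 0 l = V 0 (l * gen_b)))"
    (is "realizes _ _ (\<lambda>X. \<exists>Z V. ?B X Z V)")
  unfolding realizes_def
proof (intro conjI)
  let ?R = "\<lambda>X. \<exists>Z V. ?B X Z V"
  have dP: "definable P"
    using f by (auto simp: realizes_def)
  show "definable ?R"
    by (rule definable_ex definable_conj definable_if_zero definable_eq local_intros
        definable_all_less dP[THEN definable_reindex])+
  show "sound m (Mu f) ?R"
    unfolding sound_def
  proof (intro allI impI)
    fix X l xs n
    assume R: "?R X" and c: "computes (Mu f) xs n" and xs: "length xs = m"
      "\<forall>j<m. X (Suc j) l = of_nat (xs ! j)"
    from R obtain Z V where B: "?B X Z V"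
      by (elim exE)
    have start: "\<And>l. Z 1 (l * gen_b) = 0" "\<And>l. X 0 l = V 0 (l * gen_b)"
        "\<And>j l. j < m \<Longrightarrow> Z (j + 2) (l * gen_b) = X (j + 1) l"
      and step: "\<And>l. Z 1 (l * gen_a) = Z 1 l + 1"
        "\<And>j l. j < m \<Longrightarrow> Z (j + 2) (l * gen_a) = Z (j + 2) l"
        "\<And>l. V 0 l = (if Z 0 l = 0 then Z 1 l else V 0 (l * gen_a))"
      and P: "P Z"
      by (insert B) iprover+
    from c have n: "computes f (n # xs) 0" "\<And>k. k < n \<Longrightarrow> \<exists>y. computes f (k # xs) (Suc y)"
      by (auto elim: computes_cases)
    have f_value: "Z 0 l = of_nat y" if "computes f (k # xs) y" "Z 1 l = of_nat k"
      "\<And>j. j < m \<Longrightarrow> Z (j + 2) l = of_nat (xs ! j)" for k l y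
    proof (rule soundD[of "Suc m" f P Z "k # xs" y l])
      show "sound (Suc m) f P"
        using f by (simp add: realizes_def)
      show "length (k # xs) = Suc m"
        using xs(1) by simp
      show "Z (Suc j) l = of_nat ((k # xs) ! j)" if "j < Suc m" for j
        using that \<open>Z 1 l = of_nat k\<close> \<open>\<And>j. j < m \<Longrightarrow> Z (j + 2) l = of_nat (xs ! j)\<close>
        by (cases j) auto
    qed (fact P that(1))+
    \<comment> \<open>Induction on the distance \<open>d\<close> from the candidate \<open>k\<close>
      to the least zero \<open>n\<close>.\<close>
    have search: "V 0 l = of_nat n" if "k + d = n" "Z 1 l = of_nat k"
      "\<And>j. j < m \<Longrightarrow> Z (j + 2) l = of_nat (xs ! j)" for k d l
      using that
    proof (induction d arbitrary: k l)
      case 0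
      then have "Z 0 l = 0"
        using f_value[OF n(1), of l] by simp
      with 0 show ?case
        by (simp add: step(3))
    next
      case (Suc d)
      then obtain y where "computes f (k # xs) (Suc y)"
        using n(2)[of k] by auto
      \<comment> \<open>A successor does not vanish in characteristic zero, so the equation for
        \<open>V 0\<close> refers to the next candidate.\<close>
      from f_value[OF this] Suc.prems have "Z 0 l \<noteq> 0"
        by (simp del: of_nat_Suc)
      then have "V 0 l = V 0 (l * gen_a)"
        using step(3)[of l] by simp
      also have "\<dots> = of_nat n"
        using Suc.prems step(1,2) by (intro Suc.IH[of "Suc k"]) (auto simp: add.commute)
      finally show ?case .
    qed
    show "X 0 l = of_nat n"
      unfolding start(2)
    proof (rule search[of 0 n])
      show "Z (j + 2) (l * gen_b) = of_nat (xs ! j)" if "j < m" for j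
        unfolding start(3)[OF that] using that xs(2) by simp
    qed (simp_all only: start(1) of_nat_0 add_0)
  qed
  show "complete (Mu f) ?R"
    unfolding complete_def
  proof (intro allI impI)
    fix N :: "nat \<Rightarrow> M2 \<Rightarrow> nat"
    assume N: "\<forall>l. N 0 l = total_value (Mu f) (\<lambda>j. N (Suc j) l)"
    \<comment> \<open>\<open>t l\<close> holds the candidate followed by the parameters. Candidates
      grow forever along \<open>gen_a\<close>, even after a zero has been found.\<close>
    obtain t where t: "\<And>l. t (l * gen_b) = case_nat 0 (\<lambda>j. N (Suc j) l)"
      "\<And>l. t (l * gen_a) = case_nat (Suc (t l 0)) (\<lambda>j. t l (Suc j))"
      using tree_recursion[of "\<lambda>l. case_nat 0 (\<lambda>j. N (Suc j) l)"
        "\<lambda>c. case_nat (Suc (c 0)) (\<lambda>j. c (Suc j))"]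
      by blast
    define Z where "Z = case_nat (\<lambda>l. total_value f (t l)) (\<lambda>j l. t l j)"
    define V where "V l = search_from
      (\<lambda>n. total_value f (case_nat n (\<lambda>j. t l (Suc j)))) (t l 0)" for l
    have eta: "case_nat (t l 0) (\<lambda>j. t l (Suc j)) = t l" for l
      by (auto simp: fun_eq_iff split: nat.split)
    have V: "V l = (if Z 0 l = 0 then t l 0 else V (l * gen_a))" for l
      unfolding V_def by (subst search_from_step) (simp add: Z_def eta t(2))
    have P: "P (\<lambda>i l. of_nat (Z i l))"
      using f by (intro completeD[of f P]) (auto simp: realizes_def Z_def)
    have Z: "Z 1 l = t l 0" "Z (j + 2) l = t l (Suc j)" for j l
      by (simp_all add: Z_def numeral_2_eq_2)
    let ?X = "\<lambda>i l. of_nat (N i l) :: 'k" and ?Z = "\<lambda>i l. of_nat (Z i l) :: 'k"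
      and ?V = "\<lambda>(i::nat) l. of_nat (V l) :: 'k"
    have "?B ?X ?Z ?V"
    proof (intro conjI allI impI)
      show "?Z 1 (l * gen_b) = 0" "?Z 1 (l * gen_a) = ?Z 1 l + 1" for l
        by (simp_all only: Z t) simp_all
      show "?Z (j + 2) (l * gen_b) = ?X (j + 1) l" "?Z (j + 2) (l * gen_a) = ?Z (j + 2) l" for j l
        by (simp_all only: Z t) simp_all
      show "?V 0 l = (if ?Z 0 l = 0 then ?Z 1 l else ?V 0 (l * gen_a))" for l
        by (simp only: Z V[of l]) simp
      show "?X 0 l = ?V 0 (l * gen_b)" for l
        using N by (simp add: V_def t(1))
    qed (fact P)
    then show "?R ?X"
      by (intro exI)
  qed
qed

text \<open>The number of inputs varies in the induction, since the constituents of a function have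
  different arities.\<close>

lemma realizable: "\<exists>P. realizes m f P"
proof (induction f arbitrary: m)
  case Zero
  show ?case using realizes_Zero by blast
next
  case Succ
  show ?case using realizes_Succ by blast
next
  case (Proj i)
  show ?case using realizes_Proj by blast
next
  case (Comp f gs)
  obtain P where "realizes (length gs) f P"
    using Comp.IH(1) by blast
  moreover have "\<forall>j. \<exists>Q. j < length gs \<longrightarrow> realizes m (gs ! j) Q"
    using Comp.IH(2) nth_mem by blast
  then obtain Q where "\<And>j. j < length gs \<Longrightarrow> realizes m (gs ! j) (Q j)"
    by metis
  ultimately show ?case
    by (intro exI) (rule realizes_Comp)
next
  case (PrimRec f g)
  obtain P Q where "realizes (m - 1) f P" "realizes (Suc m) g Q"
    using PrimRec.IH by blast
  then show ?case
    by (intro exI) (rule realizes_PrimRec)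
next
  case (Mu f)
  obtain P where "realizes (Suc m) f P"
    using Mu.IH by blast
  then show ?case
    by (intro exI) (rule realizes_Mu)
qed

text \<open>The input is passed as \<open>- c\<close>, so that only nonnegative constants have to be encoded.\<close>

lemma system_for_value_zero:
  obtains es where "\<And>e. e \<in> set es \<Longrightarrow> fst ` set e \<subseteq> K"
    "\<And>c y. computes f [c] y \<Longrightarrow>
      (\<exists>X. (\<forall>l. X 0 l = - of_nat c) \<and> (\<forall>e\<in>set es. \<forall>l. mexpr_val X e l = 0)) \<longleftrightarrow> y = 0"
proof -
  obtain P where P: "definable P" "sound 1 f P" "complete f P"
    using realizable[of 1 f] unfolding realizes_def by blast
  define R where "R X \<longleftrightarrow> (\<exists>Z. P Z \<and> (\<forall>l. Z 0 l = 0) \<and> (\<forall>l. Z 1 l + X 0 l = 0))"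
    for X :: "nat \<Rightarrow> M2 \<Rightarrow> 'k"
  have "definable R"
    unfolding R_def
    by (rule definable_ex definable_conj definable_eq local_intros P(1)[THEN definable_reindex])+
  then obtain es where es: "\<forall>e\<in>set es. fst ` set e \<subseteq> K"
    "\<forall>X. R X \<longleftrightarrow> (\<exists>Y. \<forall>e\<in>set es. \<forall>l. mexpr_val (join X Y) e l = 0)"
    unfolding definable_def by (elim exE conjE)
  note R_iff = es(2)[rule_format]
  show ?thesis
  proof
    fix c y assume y: "computes f [c] y"
    let ?X = "\<lambda>i l. - of_nat c :: 'k"
    have input: "X 0 l = of_nat y" if "P X" "\<And>l. X 1 l = of_nat c" for X l
      using soundD[OF P(2) that(1) y, of l] that(2) by simp
    let ?N = "\<lambda>i (l :: M2). if i = 0 then total_value f (\<lambda>_. c) else c"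
    have PN: "P (\<lambda>i l. of_nat (?N i l))"
      by (rule completeD[OF P(3)]) simp
    \<comment> \<open>Soundness applied to the canonical solution shows that the total extension
      agrees with the computed value.\<close>
    from input[OF PN] have "total_value f (\<lambda>_. c) = y"
      by simp
    then have Py: "P (\<lambda>i l. of_nat (if i = 0 then y else c))"
      using PN by (simp cong: if_cong)
    have R: "R X \<longleftrightarrow> y = 0" if X: "\<And>l. X 0 l = - of_nat c" for X
    proof
      assume "R X"
      then obtain Z where Z: "P Z" "\<And>l. Z 0 l = 0" "\<And>l. Z 1 l + X 0 l = 0"
        unfolding R_def by blast
      have "Z 1 l = of_nat c" for l
        using Z(3)[of l] by (simp add: X)
      from input[OF Z(1) this, of 1] Z(2) show "y = 0"
        by simp
    next
      assume "y = 0"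
      with Py show "R X"
        unfolding R_def by (intro exI[of _ "\<lambda>i l. of_nat (if i = 0 then y else c)"]) (simp add: X)
    qed
    show "(\<exists>X. (\<forall>l. X 0 l = - of_nat c) \<and> (\<forall>e\<in>set es. \<forall>l. mexpr_val X e l = 0)) \<longleftrightarrow> y = 0"
    proof
      assume "\<exists>X. (\<forall>l. X 0 l = - of_nat c) \<and> (\<forall>e\<in>set es. \<forall>l. mexpr_val X e l = 0)"
      then obtain X where X: "\<And>l. X 0 l = - of_nat c" "\<forall>e\<in>set es. \<forall>l. mexpr_val X e l = 0"
        by blast
      \<comment> \<open>Any family splits into parameters and witnesses, and variable 0 is parameter
        0 in both numberings.\<close>
      have "join (\<lambda>i. X (2 * i)) (\<lambda>i. X (Suc (2 * i))) = X"
        by (rule join_split)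
      with X(2) have "R (\<lambda>i. X (2 * i))"
        unfolding R_iff by metis
      with R[of "\<lambda>i. X (2 * i)"] X(1) show "y = 0"
        by simp
    next
      assume "y = 0"
      with R[of ?X] have "R ?X" by simp
      then obtain Y where "\<forall>e\<in>set es. \<forall>l. mexpr_val (join ?X Y) e l = 0"
        unfolding R_iff by blast
      then show "\<exists>X. (\<forall>l. X 0 l = - of_nat c) \<and> (\<forall>e\<in>set es. \<forall>l. mexpr_val X e l = 0)"
        by (intro exI[of _ "join ?X Y"]) (simp add: join_def)
    qed
  qed (use es(1) in blast)
qed

end


section \<open>The reduction\<close>

lemma computes_const: "\<exists>f. \<forall>xs. computes f xs c"
proof (induction c)
  case 0
  show ?case using computes.Zero by blast
next
  case (Suc c)
  then obtain f where "\<And>xs. computes f xs c" by blast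
  then have "computes (recf.Comp Succ [f]) xs (Suc c)" for xs
    by (intro computes.Comp[where ys = "[c]"] computes.Succ) simp
  then show ?case by blast
qed

lemma computes_Comp1:
  "computes g xs y \<Longrightarrow> computes f [y] z \<Longrightarrow> computes (recf.Comp f [g]) xs z"
  by (rule computes.Comp[where ys = "[y]"]) simp_all

lemma computes_Comp2:
  "computes g xs y \<Longrightarrow> computes h xs y' \<Longrightarrow> computes f [y, y'] z \<Longrightarrow>
    computes (recf.Comp f [g, h]) xs z"
  by (rule computes.Comp[where ys = "[y, y']"]) simp_all

lemma computes_Proj: "i < length xs \<Longrightarrow> y = xs ! i \<Longrightarrow> computes (Proj i) xs y"
  by (simp add: computes.Proj)

lemma computes_add: "\<exists>f. \<forall>m n. computes f [m, n] (m + n)"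
proof -
  let ?f = "PrimRec (Proj 0) (recf.Comp Succ [Proj 1])"
  have "computes ?f [m, n] (m + n)" for m n
  proof (induction m)
    case 0
    show ?case by (auto intro!: computes.PrimRec_0 computes_Proj)
  next
    case (Suc m)
    have "computes (recf.Comp Succ [Proj 1]) [m, m + n, n] (Suc m + n)"
      using computes.Succ[of "m + n"] by (intro computes_Comp1[where y = "m + n"] computes_Proj) simp_all
    with Suc show ?case by (rule computes.PrimRec_Suc)
  qed
  then show ?thesis by blast
qed

lemma computes_triangle: "\<exists>f. \<forall>n. computes f [n] (triangle n)"
proof -
  obtain add where add: "\<And>m n. computes add [m, n] (m + n)"
    using computes_add by blast
  let ?g = "recf.Comp add [Proj 1, recf.Comp Succ [Proj 0]]"
  have "computes (PrimRec Zero ?g) [n] (triangle n)" for n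
  proof (induction n)
    case 0
    show ?case by (auto intro!: computes.PrimRec_0 computes.Zero)
  next
    case (Suc n)
    have "computes ?g [n, triangle n] (triangle n + Suc n)"
      by (rule computes_Comp2[OF _ _ add])
        (auto intro!: computes_Proj computes_Comp1[where y = n] computes.Succ)
    with Suc show ?case
      by (auto intro: computes.PrimRec_Suc)
  qed
  then show ?thesis by blast
qed

lemma computes_prod_encode: "\<exists>f. \<forall>m n. computes f [m, n] (prod_encode (m, n))"
proof -
  obtain add where add: "\<And>m n. computes add [m, n] (m + n)"
    using computes_add by blast
  obtain tri where tri: "\<And>n. computes tri [n] (triangle n)"
    using computes_triangle by blast
  have "computes (recf.Comp add [recf.Comp tri [add], Proj 0]) [m, n] (prod_encode (m, n))" for m n
    unfolding prod_encode_def
    by (auto intro!: computes_Comp2[OF _ _ add] computes_Comp1[OF add tri] computes_Proj)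
  then show ?thesis by blast
qed

definition computable :: "(nat \<Rightarrow> nat) \<Rightarrow> bool" where
  "computable h \<longleftrightarrow> (\<exists>f. \<forall>n. computes f [n] (h n))"

lemma computable_const: "computable (\<lambda>n. c)"
  using computes_const[of c] unfolding computable_def by blast

lemma computable_id: "computable (\<lambda>n. n)"
  unfolding computable_def by (rule exI[of _ "Proj 0"]) (simp add: computes_Proj)

lemma computable_Suc: "computable h \<Longrightarrow> computable (\<lambda>n. Suc (h n))"
  unfolding computable_def by (meson computes_Comp1 computes.Succ)

lemma computable_prod_encode:
  "computable g \<Longrightarrow> computable h \<Longrightarrow> computable (\<lambda>n. prod_encode (g n, h n))"
  using computes_prod_encode unfolding computable_def by (meson computes_Comp2)

text \<open>The input enters a system as a coefficient, whose code is computed by repeatedly adding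
  1 with the addition of the coding.\<close>

lemma computable_enc_of_nat:
  assumes "is_subfield K" "computable_coding K enc"
  shows "computable (\<lambda>n. enc (of_nat n :: 'k::field_char_0))"
proof -
  interpret coeff_field K by (rule coeff_field.intro) (rule assms(1))
  obtain add where add: "\<And>x y. x \<in> K \<Longrightarrow> y \<in> K \<Longrightarrow> computes add [enc x, enc y] (enc (x + y))"
    using assms(2) unfolding computable_coding_def by blast
  obtain zero one where const: "\<And>xs. computes zero xs (enc 0)" "\<And>xs. computes one xs (enc 1)"
    using computes_const by metis
  let ?g = "recf.Comp add [Proj 1, one]"
  have "computes (PrimRec zero ?g) [n] (enc (of_nat n))" for n
  proof (induction n)
    case 0
    show ?case using const(1) by (auto intro: computes.PrimRec_0)
  next
    case (Suc n)
    have "computes ?g [n, enc (of_nat n)] (enc (of_nat n + 1))"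
      using of_nat_in_K[of n] of_nat_in_K[of 1]
      by (intro computes_Comp2[OF _ const(2) add] computes_Proj) simp_all
    with Suc show ?case
      by (auto intro: computes.PrimRec_Suc simp: add.commute)
  qed
  then show ?thesis
    unfolding computable_def by blast
qed

lemma le_list_encode: "x \<in> set xs \<Longrightarrow> x \<le> list_encode xs"
proof (induction xs)
  case (Cons y xs)
  have "y \<le> prod_encode (y, list_encode xs)" "list_encode xs \<le> prod_encode (y, list_encode xs)"
    by (rule le_prod_encode_1 le_prod_encode_2)+
  with Cons show ?case by auto
qed simp

text \<open>The code of a system bounds the indices of its variables, so it may serve as their number.\<close>

lemma mexprs_code_bound:
  assumes "e \<in> set es" "fst ` set e \<subseteq> K"
  shows "e \<in> mexprs (Suc (list_encode (map (mexpr_code enc) es))) K"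
proof -
  have "i \<le> list_encode (map (mexpr_code enc) es)" if "(a, vs) \<in> set e" "(i, m) \<in> set vs" for a vs i m
  proof -
    have "i \<le> indet_code (i, m)"
      by (simp add: indet_code_def le_prod_encode_1)
    also have "\<dots> \<le> list_encode (map indet_code vs)"
      using that(2) by (intro le_list_encode) simp
    also have "\<dots> \<le> term_code enc (a, vs)"
      by (simp add: term_code_def le_prod_encode_2)
    also have "\<dots> \<le> mexpr_code enc e"
      unfolding mexpr_code_def using that(1) by (intro le_list_encode) force
    also have "\<dots> \<le> list_encode (map (mexpr_code enc) es)"
      using assms(1) by (intro le_list_encode) simp
    finally show ?thesis .
  qed
  with assms(2) show ?thesis
    unfolding mexprs_def by (auto simp: less_Suc_eq_le)
qed

section \<open>From expressions to finite polynomial systems\<close>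

lemma mexpr_poly_in_mpolys:
  assumes "is_subfield K" "e \<in> mexprs n K"
  shows "mexpr_poly e \<in> mpolys n K"
proof -
  have prod: "(\<Prod>v\<leftarrow>vs. Indet v) \<in> mpolys n K" if "\<forall>(i, m)\<in>set vs. i < n" for vs :: "(nat \<times> M2) list"
    using that by (induction vs)
      (auto intro!: mpolys_1 mpolys_mult mpolys_Indet assms(1))
  show ?thesis
    using assms(2) unfolding mexpr_poly_def mexprs_def
    by (induction e)
      (auto intro!: mpolys_0 mpolys_add mpolys_mult mpolys_Const prod assms(1))
qed

lemma mexpr_val_cong:
  assumes "e \<in> mexprs n K" "\<And>i. i < n \<Longrightarrow> X i = Y i"
  shows "mexpr_val X e = mexpr_val Y e"
proof
  fix l
  have "(\<Prod>(i, m)\<leftarrow>vs. X i (l * m)) = (\<Prod>(i, m)\<leftarrow>vs. Y i (l * m))" if "(a, vs) \<in> set e" for a vs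
    using that assms by (intro arg_cong[of _ _ prod_list] map_cong) (fastforce simp: mexprs_def)+
  then show "mexpr_val X e l = mexpr_val Y e l"
    unfolding mexpr_val_def by (intro arg_cong[of _ _ sum_list] map_cong) auto
qed

text \<open>Tuples and infinite families are interchangeable here, as the expressions involve only
  the first \<open>n\<close> variables.\<close>

lemma solvable_iff:
  assumes "set es \<subseteq> mexprs n K"
  shows "(\<exists>xs. is_solution n (mexpr_poly ` set es) xs) \<longleftrightarrow>
    (\<exists>X. \<forall>e\<in>set es. \<forall>l. mexpr_val X e l = 0)"
proof
  assume "\<exists>xs. is_solution n (mexpr_poly ` set es) xs"
  then show "\<exists>X. \<forall>e\<in>set es. \<forall>l. mexpr_val X e l = 0"
    by (auto simp: is_solution_def mpoly_eval_mexpr_poly fun_eq_iff)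
next
  assume "\<exists>X. \<forall>e\<in>set es. \<forall>l. mexpr_val X e l = 0"
  then obtain X where X: "\<forall>e\<in>set es. \<forall>l. mexpr_val X e l = 0" by blast
  have "mexpr_val ((!) (map X [0..<n])) e = mexpr_val X e" if "e \<in> set es" for e
    using assms that by (intro mexpr_val_cong[of e n K]) auto
  with X have "is_solution n (mexpr_poly ` set es) (map X [0..<n])"
    by (auto simp: is_solution_def mpoly_eval_mexpr_poly fun_eq_iff)
  then show "\<exists>xs. is_solution n (mexpr_poly ` set es) xs" ..
qed

section \<open>The diagonal argument\<close>

theorem proposition3p10:
  fixes k\<^sub>0 :: "'k::field_char_0 set" and enc :: "'k \<Rightarrow> nat"
  assumes "is_subfield k\<^sub>0" and "computable_coding k\<^sub>0 enc"
  shows "undecidable_problem (system_code k\<^sub>0 enc)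
     {(n, F :: (M2, 'k) mpoly set). finite F \<and> F \<subseteq> mpolys n k\<^sub>0}
     (\<lambda>(n, F). \<exists>xs :: (M2 \<Rightarrow> 'k) list. is_solution n F xs)"
proof
  interpret coeff_field k\<^sub>0 by (rule coeff_field.intro) (rule assms(1))
  assume "decidable_problem (system_code k\<^sub>0 enc)
     {(n, F :: (M2, 'k) mpoly set). finite F \<and> F \<subseteq> mpolys n k\<^sub>0}
     (\<lambda>(n, F). \<exists>xs :: (M2 \<Rightarrow> 'k) list. is_solution n F xs)"
  then obtain f where f_decides: "\<forall>i\<in>{(n, F :: (M2, 'k) mpoly set). finite F \<and> F \<subseteq> mpolys n k\<^sub>0}. \<forall>c.
      system_code k\<^sub>0 enc c i \<longrightarrow> computes f [c]
        (if (case i of (n, F) \<Rightarrow> \<exists>xs :: (M2 \<Rightarrow> 'k) list. is_solution n F xs) then 1 else 0)"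
    unfolding decidable_problem_def by (elim exE)
  have f: "computes f [c]
      (if \<exists>xs :: (M2 \<Rightarrow> 'k) list. is_solution n F xs then 1 else 0)"
    if "finite F" "F \<subseteq> mpolys n k\<^sub>0" "system_code k\<^sub>0 enc c (n, F)" for n F c
    using bspec[OF f_decides, of "(n, F)"] that by simp
  \<comment> \<open>The polynomial \<open>X_0 + p\<close>, whose vanishing fixes the input variable
    to \<open>- of_nat p\<close>.\<close>
  define input :: "nat \<Rightarrow> 'k mexpr" where "input p = [(1, [(0, 1)]), (of_nat p, [])]" for p
  \<comment> \<open>By the cons clause of \<open>list_encode\<close>, this prepends
    \<open>input p\<close> to the list of equations coded by \<open>p\<close>; the variables number
    \<open>Suc p\<close>.\<close>
  define S where "S p = prod_encode (Suc p, Suc (prod_encode (mexpr_code enc (input p), p)))" for p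
  have "computable (\<lambda>p. mexpr_code enc (input p))"
    \<comment> \<open>The lists have fixed length, so their codes unfold to successors and
      pairings.\<close>
    unfolding mexpr_code_def input_def term_code_def list.map list_encode.simps prod.case
    by (intro computable_const computable_Suc computable_prod_encode
        computable_enc_of_nat[OF assms])
  then have "computable S"
    unfolding S_def by (intro computable_id computable_Suc computable_prod_encode)
  then obtain s where s: "\<And>p. computes s [p] (S p)"
    unfolding computable_def by blast
  obtain es where es: "\<And>e. e \<in> set es \<Longrightarrow> fst ` set e \<subseteq> k\<^sub>0"
    "\<And>c y. computes (recf.Comp f [s]) [c] y \<Longrightarrow>
      (\<exists>X. (\<forall>l. X 0 l = - of_nat c) \<and> (\<forall>e\<in>set es. \<forall>l. mexpr_val X e l = 0)) \<longleftrightarrow> y = 0"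
    by (rule system_for_value_zero) blast
  \<comment> \<open>The diagonal choice: the code of the equations for \<open>f\<close> after
    \<open>s\<close> becomes their own input.\<close>
  define p where "p = list_encode (map (mexpr_code enc) es)"
  define F where "F = mexpr_poly ` set (input p # es)"
  have sub: "set (input p # es) \<subseteq> mexprs (Suc p) k\<^sub>0"
  proof -
    have "input p \<in> mexprs (Suc p) k\<^sub>0"
      using of_nat_in_K[of p] of_nat_in_K[of 1] by (simp add: input_def mexprs_def)
    moreover have "set es \<subseteq> mexprs (Suc p) k\<^sub>0"
      using mexprs_code_bound[OF _ es(1)] unfolding p_def by blast
    ultimately show ?thesis by simp
  qed
  have "(\<forall>l. mexpr_val X (input p) l = 0) \<longleftrightarrow> (\<forall>l. X 0 l = - of_nat p)" for X
    by (simp add: mexpr_val_def input_def eq_neg_iff_add_eq_0)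
  then have solvable: "(\<exists>xs. is_solution (Suc p) F xs) \<longleftrightarrow>
      (\<exists>X. (\<forall>l. X 0 l = - of_nat p) \<and> (\<forall>e\<in>set es. \<forall>l. mexpr_val X e l = 0))"
    unfolding F_def solvable_iff[OF sub] by simp
  have "system_code k\<^sub>0 enc (S p) (Suc p, F)"
    unfolding system_code_def prod.case F_def
    by (rule exI[of _ "input p # es"]) (use sub in \<open>simp add: S_def p_def\<close>)
  moreover have "F \<subseteq> mpolys (Suc p) k\<^sub>0"
    using sub mexpr_poly_in_mpolys[OF assms(1)] unfolding F_def by blast
  ultimately have "computes f [S p] (if \<exists>xs. is_solution (Suc p) F xs then 1 else 0)"
    by (intro f) (simp_all add: F_def)
  \<comment> \<open>The system is solvable iff the verdict is 0, but the verdict 0 means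
    unsolvable.\<close>
  from es(2)[OF computes_Comp1[OF s this]] show False
    unfolding solvable[symmetric] by (cases "\<exists>xs. is_solution (Suc p) F xs") simp_all
qed

end
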